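(* Suppose the observation model factorizes as $$p_Y(Y\mid X,\xi)=\prod_{i=1}^r p_{Y_i}(Y_i\mid X_i,\xi_i),$$ and that the working models $\{\tilde p_X(X_i\mid g_i(\eta)) : i=1,\ldots,r\}$ satisfy the distributed separability condition with respect to the scientific model $p_X(X\mid\theta)$, i.e. for each $\theta$ there is a probability measure $p_\eta(\cdot\mid\theta)$ on the space of $\eta$ such that $$p_X(X\mid\theta)=\int_\eta\Big[\prod_{i=1}^r \tilde p_X(X_i\mid g_i(\eta))\Big]\,\mathrm{d}p_\eta(\eta\mid\theta).$$ Then: (1) If for each $i$ the statistic $T_i(Y_i)$ is sufficient for $\{g_i(\eta),\xi_i\}$ under the model $$\tilde p_Y(Y_i\mid g_i(\eta),\xi_i)=\int p_{Y_i}(Y_i\mid X_i,\xi_i)\,\tilde p_X(X_i\mid g_i(\eta))\,\mathrm{d}\mu_{X_i}(X_i),$$ then the collection $T(Y)=\{T_i(Y_i): i=1,\ldots,r\}$ is jointly sufficient for $\{\theta,\xi\}$, in the sense that $L(\theta,\xi\mid T(Y))=L(\theta,\xi\mid Y)$. (2) Suppose additionally that $\{\xi_1,\ldots,\xi_r\}$ forms a partition of $\xi$ and that the prior on $\xi$ factorizes as $\pi(\xi)\,\mathrm{d}\mu_\xi=\prod_{i=1}^r\pi_{\xi_i}(\xi_i)\,\mathrm{d}\mu_{\xi_i}$. For each $i$ let $T_i(Y_i)$ be as in (1), and let $T_i^B(Y_i)$ be a statistic that is sufficient for $g_i(\eta)$ under the model $$\tilde p_Y(Y_i\mid g_i(\eta))=\int\!\!\int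 p_{Y_i}(Y_i\mid X_i,\xi_i)\,\tilde p_X(X_i\mid g_i(\eta))\,\pi_{\xi_i}(\xi_i)\,\mathrm{d}\mu_{X_i}(X_i)\,\mathrm{d}\mu_{\xi_i}(\xi_i).$$ Then both $T(Y)=\{T_i(Y_i): i=1,\ldots,r\}$ and $T^B(Y)=\{T_i^B(Y_i): i=1,\ldots,r\}$ are Bayesianly sufficient for $\theta$, in the sense that $P(\theta\mid T(Y))=P(\theta\mid Y)$ and $P(\theta\mid T^B(Y))=P(\theta\mid Y)$.
   Context: Setting. $X$ denotes (unobserved) scientific variables and $Y$ the observed raw data. Their joint density with respect to a product measure $\mu_X\times\mu_Y$ is $$p_{Y,X}(Y,X\mid\theta,\xi)=p_Y(Y\mid X,\xi)\,p_X(X\mid\theta),$$ where $p_X(\cdot\mid\theta)$ is the scientific model with parameter $\theta$ of interest and $p_Y(\cdot\mid X,\xi)$ is the observation model with nuisance parameter $\xi$. The parameters $\theta$ and $\xi$ are distinct; in Bayesian settings they are independent a priori. The marginal model for the data is $p_Y(Y\mid\theta,\xi)=\int p_Y(Y\mid X,\xi)\,p_X(X\mid\theta)\,\mathrm{d}\mu_X(X)$. There are $r$ researchers. Researcher $i$ has data $Y_i$, scientific variables $X_i$ and nuisance parameter $\xi_i$ (a part of $\xi$). $\{Y_1,\ldots,Y_r\}$ is a partition of $Y$ and $\{X_1,\ldots,X_r\}$ is a partition of $X$; the base measures are products: $\mu_Y=\prod_{i=1}^r\mu_{Y_i}$ and $\mu_X=\prod_{i=1}^r\mu_{X_i}$.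 Researcher $i$ uses a working model, namely a family of probability densities $\tilde p_X(X_i\mid g_i(\eta))$ for $X_i$ with respect to $\mu_{X_i}$, where $\eta$ is a common working parameter and $g_i$ is a function of $\eta$. Sufficiency of a statistic is in the usual (factorization) sense for the family of densities obtained by letting the indicated parameters vary. $L(\theta,\xi\mid D)$ denotes the likelihood function of $(\theta,\xi)$ based on data $D$ under the joint model above (after integrating out $X$), and equality of likelihoods is understood up to a factor not depending on the parameters. $P(\theta\mid D)$ denotes the posterior distribution of $\theta$ given data $D$, under the joint model above, with the prior $\pi$ on $\xi$ and an independent prior on $\theta$. *)

theory Defs
  imports "HOL-Probability.Probability"
begin

definition prob_density :: "'a measure \<Rightarrow> ('a \<Rightarrow> ennreal) \<Rightarrow> bool" where
  "prob_density M f \<longleftrightarrow> f \<in> borel_measurable M \<and> (\<integral>\<^sup>+ x. f x \<partial>M) = 1"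

text \<open>The model for the data \<open>y\<close> once the scientific variables are integrated out. It is used both
  for the joint model and, researcher by researcher, for the working models.\<close>

definition marginal_model ::
  "'x measure \<Rightarrow> ('y \<Rightarrow> 'x \<Rightarrow> 'xi \<Rightarrow> ennreal) \<Rightarrow> ('x \<Rightarrow> 'theta \<Rightarrow> ennreal) \<Rightarrow> 'y \<Rightarrow> 'theta \<Rightarrow> 'xi \<Rightarrow> ennreal"
  where "marginal_model MX pY pX y \<theta> \<xi> = (\<integral>\<^sup>+ x. pY y x \<xi> * pX x \<theta> \<partial>MX)"

text \<open>Densities are only determined up to null sets, so identities between densities are required
  almost everywhere with respect to the base measure.\<close>

definition distributed_separable ::
  "'i set \<Rightarrow> ('i \<Rightarrow> 'x measure) \<Rightarrow> 'eta measure \<Rightarrow> 'theta set \<Rightarrow> (('i \<Rightarrow> 'x) \<Rightarrow> 'theta \<Rightarrow> ennreal) \<Rightarrow>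
   ('i \<Rightarrow> 'x \<Rightarrow> 'gam \<Rightarrow> ennreal) \<Rightarrow> ('i \<Rightarrow> 'eta \<Rightarrow> 'gam) \<Rightarrow> bool"
  where "distributed_separable I MX H \<Theta> pX wX g \<longleftrightarrow>
    (\<forall>\<theta>\<in>\<Theta>. \<exists>P. prob_space P \<and> sets P = sets H \<and>
      (AE x in PiM I MX. pX x \<theta> = (\<integral>\<^sup>+ \<eta>. (\<Prod>i\<in>I. wX i (x i) (g i \<eta>)) \<partial>P)))"

text \<open>Sufficiency of \<open>T\<close> for the family of densities \<open>f \<psi>\<close> (\<open>\<psi> \<in> \<Psi>\<close>) with respect to \<open>M\<close>, in the
  sense of the Fisher-Neyman factorization. No joint measurability of \<open>g\<close> in the parameter is
  required.\<close>

definition sufficient ::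
  "'y measure \<Rightarrow> 't measure \<Rightarrow> 'psi set \<Rightarrow> ('psi \<Rightarrow> 'y \<Rightarrow> ennreal) \<Rightarrow> ('y \<Rightarrow> 't) \<Rightarrow> bool"
  where "sufficient M N \<Psi> f T \<longleftrightarrow> T \<in> M \<rightarrow>\<^sub>M N \<and>
    (\<exists>(h :: 'y \<Rightarrow> real) (g :: 'psi \<Rightarrow> 't \<Rightarrow> real).
      h \<in> borel_measurable M \<and> (\<forall>y. 0 \<le> h y) \<and>
      (\<forall>\<psi>\<in>\<Psi>. g \<psi> \<in> borel_measurable N \<and> (\<forall>t. 0 \<le> g \<psi> t) \<and>
        (AE y in M. f \<psi> y = ennreal (h y * g \<psi> (T y)))))"

text \<open>\<open>L \<psi> t\<close> is a likelihood function based on the observation \<open>T y = t\<close>: a density, with respect to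
  a dominating measure common to all parameters, of the law of \<open>T y\<close> when \<open>y\<close> has density \<open>f \<psi>\<close>.\<close>

definition statistic_likelihood ::
  "'y measure \<Rightarrow> 't measure \<Rightarrow> 'psi set \<Rightarrow> ('psi \<Rightarrow> 'y \<Rightarrow> ennreal) \<Rightarrow> ('y \<Rightarrow> 't) \<Rightarrow>
   ('psi \<Rightarrow> 't \<Rightarrow> ennreal) \<Rightarrow> bool"
  where "statistic_likelihood M N \<Psi> f T L \<longleftrightarrow>
    (\<exists>\<nu>. sigma_finite_measure \<nu> \<and> sets \<nu> = sets N \<and>
      (\<forall>\<psi>\<in>\<Psi>. L \<psi> \<in> borel_measurable N \<and> distr (density M (f \<psi>)) N T = density \<nu> (L \<psi>)))"

text \<open>The likelihood based on \<open>T y\<close> equals the likelihood \<open>f \<psi> y\<close> based on \<open>y\<close>, up to a positive factor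
  that does not depend on the parameter, for almost all data \<open>y\<close> under each member of the model.
  (Data in a region of model probability 0 have to be excluded: there \<open>f \<psi> y\<close> may vanish for all \<open>\<psi>\<close>
  although \<open>T y\<close> is a possible value of the statistic.) The first conjunct excludes the vacuous
  case in which no likelihood based on \<open>T y\<close> exists.\<close>

definition same_likelihood ::
  "'y measure \<Rightarrow> 't measure \<Rightarrow> 'psi set \<Rightarrow> ('psi \<Rightarrow> 'y \<Rightarrow> ennreal) \<Rightarrow> ('y \<Rightarrow> 't) \<Rightarrow> bool"
  where "same_likelihood M N \<Psi> f T \<longleftrightarrow> T \<in> M \<rightarrow>\<^sub>M N \<and>
    (\<exists>L. statistic_likelihood M N \<Psi> f T L) \<and>
    (\<forall>L. statistic_likelihood M N \<Psi> f T L \<longrightarrow>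
      (\<exists>c :: 'y \<Rightarrow> real. c \<in> borel_measurable M \<and> (\<forall>y. 0 < c y) \<and>
        (\<forall>\<psi>\<in>\<Psi>. \<forall>\<psi>'\<in>\<Psi>. AE y in density M (f \<psi>'). f \<psi> y = ennreal (c y) * L \<psi> (T y))))"

text \<open>\<open>K\<close> is a version of the posterior distribution of the first component given the second one
  under the joint law \<open>J\<close>, that is, a regular conditional distribution.\<close>

definition posterior_version ::
  "('theta \<times> 'd) measure \<Rightarrow> 'theta measure \<Rightarrow> 'd measure \<Rightarrow> ('d \<Rightarrow> 'theta measure) \<Rightarrow> bool"
  where "posterior_version J R D K \<longleftrightarrow> K \<in> D \<rightarrow>\<^sub>M prob_algebra R \<and>
    (\<forall>B\<in>sets R. \<forall>A\<in>sets D.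
      emeasure J (B \<times> A) = (\<integral>\<^sup>+ d\<in>A. emeasure (K d) B \<partial>distr J D snd))"

text \<open>The posterior given \<open>T y\<close> agrees with the posterior given \<open>y\<close>: some versions are almost surely
  equal as measures, and all versions almost surely give the same probability to each event. (For
  arbitrary versions the exceptional null set can be chosen independently of the event only if the
  \<open>\<sigma>\<close>-algebra of the parameter space is, say, countably generated.)\<close>

definition same_posterior ::
  "('theta \<times> 'y) measure \<Rightarrow> 'theta measure \<Rightarrow> 'y measure \<Rightarrow> 't measure \<Rightarrow> ('y \<Rightarrow> 't) \<Rightarrow> bool"
  where "same_posterior J R M N T \<longleftrightarrow> T \<in> M \<rightarrow>\<^sub>M N \<and>
    (let JT = distr J (R \<Otimes>\<^sub>M N) (\<lambda>(\<theta>, y). (\<theta>, T y)) in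
      (\<exists>KY KT. posterior_version J R M KY \<and> posterior_version JT R N KT \<and>
        (AE y in distr J M snd. KY y = KT (T y))) \<and>
      (\<forall>KY KT. posterior_version J R M KY \<longrightarrow> posterior_version JT R N KT \<longrightarrow>
        (\<forall>B\<in>sets R. AE y in distr J M snd. emeasure (KY y) B = emeasure (KT (T y)) B)))"

text \<open>The joint law of \<open>(\<theta>, y)\<close> when \<open>\<theta>\<close> has the prior \<open>R\<close>, \<open>\<xi>\<close> independently has the prior density
  \<open>\<pi>\<close> with respect to \<open>M\<xi>\<close>, and \<open>y\<close> has density \<open>f y \<theta> \<xi>\<close> with respect to \<open>MY\<close> given \<open>(\<theta>, \<xi>)\<close>.\<close>

definition joint_law ::
  "'theta measure \<Rightarrow> 'xi measure \<Rightarrow> ('xi \<Rightarrow> ennreal) \<Rightarrow> 'y measure \<Rightarrow>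
   ('y \<Rightarrow> 'theta \<Rightarrow> 'xi \<Rightarrow> ennreal) \<Rightarrow> ('theta \<times> 'y) measure"
  where "joint_law R M\<xi> \<pi> MY f =
    density (R \<Otimes>\<^sub>M MY) (\<lambda>(\<theta>, y). \<integral>\<^sup>+ \<xi>. f y \<theta> \<xi> * \<pi> \<xi> \<partial>M\<xi>)"

definition joint_statistic :: "'i set \<Rightarrow> ('i \<Rightarrow> 'y \<Rightarrow> 't) \<Rightarrow> ('i \<Rightarrow> 'y) \<Rightarrow> ('i \<Rightarrow> 't)" where
  "joint_statistic I T y = (\<lambda>i\<in>I. T i (y i))"

text \<open>The nuisance parameter \<open>\<xi>\<close> is a vector with coordinates in \<open>J\<close>; the part of \<open>\<xi>\<close> with
  coordinates in \<open>C i\<close> is \<open>restrict \<xi> (C i)\<close>. The parts may overlap in general.\<close>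

definition parts_of :: "'i set \<Rightarrow> 'k set \<Rightarrow> ('i \<Rightarrow> 'k set) \<Rightarrow> bool" where
  "parts_of I J C \<longleftrightarrow> (\<forall>i\<in>I. C i \<subseteq> J)"

definition partition_into :: "'i set \<Rightarrow> 'k set \<Rightarrow> ('i \<Rightarrow> 'k set) \<Rightarrow> bool" where
  "partition_into I J C \<longleftrightarrow> (\<Union>i\<in>I. C i) = J \<and> disjoint_family_on C I"

text \<open>\<open>\<pi>(\<xi>) d\<mu>\<^sub>\<xi> = \<Prod>\<^sub>i \<pi>\<^sub>i(\<xi>\<^sub>i) d\<mu>\<^sub>i\<close>, where \<open>\<xi>\<close> is identified with the tuple of its parts.\<close>

definition prior_factorizes ::
  "'i set \<Rightarrow> ('i \<Rightarrow> 'k set) \<Rightarrow> ('k \<Rightarrow> 'c) measure \<Rightarrow> (('k \<Rightarrow> 'c) \<Rightarrow> ennreal) \<Rightarrow>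
   ('i \<Rightarrow> ('k \<Rightarrow> 'c) measure) \<Rightarrow> ('i \<Rightarrow> ('k \<Rightarrow> 'c) \<Rightarrow> ennreal) \<Rightarrow> bool"
  where "prior_factorizes I C M\<xi> \<pi> M\<xi>i \<pi>i \<longleftrightarrow>
    (\<forall>i\<in>I. (\<lambda>\<xi>. restrict \<xi> (C i)) \<in> M\<xi> \<rightarrow>\<^sub>M M\<xi>i i) \<and>
    distr (density M\<xi> \<pi>) (PiM I M\<xi>i) (\<lambda>\<xi>. \<lambda>i\<in>I. restrict \<xi> (C i)) =
      PiM I (\<lambda>i. density (M\<xi>i i) (\<pi>i i))"

end

theory Submission
  imports Defs
begin

text \<open>
  By distributed separability and Fubini, the marginal density of the data is a mixture over \<open>\<eta>\<close> of
  products of the working densities of the individual researchers. Sufficiency turns each product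
  into \<open>h(y) k(T y)\<close>, with \<open>h\<close> free of \<open>\<eta>\<close> and \<open>\<xi>\<close>, and integrating over \<open>\<eta>\<close> preserves this form.
  The difficulty is that \<open>k\<close> need not be measurable in \<open>\<eta>\<close>. However, the product of the working
  densities is measurable in \<open>(\<eta>, y)\<close>, and a jointly measurable function all of whose sections are
  almost everywhere functions of \<open>T\<close> is a jointly measurable function of \<open>(\<eta>, T y)\<close>; this is shown
  on level sets, with Radon-Nikodym derivatives chosen measurably in the parameter.

  Any likelihood based on \<open>T y\<close> is then compared with \<open>k\<close> through a common dominating measure, and a
  version of the posterior is obtained by normalizing \<open>k\<close>. For \<open>T\<^sup>B\<close> the factorized prior is
  integrated out first, which replaces the working densities by their prior means.
\<close>

text \<open>Separability supplies the mixing measure \<open>P\<close> for each \<theta> separately,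
  with no measurability in \<theta>, so a factor \<open>k\<close> built from \<open>P\<close> cannot
  simply be integrated over \<theta> as Bayes' formula demands. Factorizations are therefore carried
  pointwise in each parameter, and the measurable choice of \<open>k\<close> is redone whenever a
  parameter is integrated: \<eta> against \<open>P\<close>, \<xi> against its prior, \<theta> in the
  posterior. In the last two cases the joint measurability it starts from is that of the models
  \<open>pX\<close> and \<open>pY\<close>.

  The factor \<open>h\<close> may vanish, and there the density does not determine \<open>k\<close>.
  Choices are made with respect to a finite measure that lives on \<open>{h > 0}\<close> and has the
  null sets of the base measure there; where \<open>h = 0\<close>, both sides of a factorization are
  zero for any choice.

  For likelihoods the natural dominating measure would be the image under \<open>T\<close> of
  \<open>h\<close> times the base measure, but this image need not be sigma-finite. The law of
  \<open>T\<close> under the finite measure just described takes its place.\<close>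

section \<open>Measurable choice for functions whose sections depend on a statistic\<close>

lemma AE_le_one_of_set_integrals:
  assumes fin: "finite_measure \<nu>" and G[measurable]: "G \<in> borel_measurable \<nu>"
    and le: "\<And>B. B \<in> sets \<nu> \<Longrightarrow> (\<integral>\<^sup>+ t. G t * indicator B t \<partial>\<nu>) \<le> emeasure \<nu> B"
  shows "AE t in \<nu>. G t \<le> (1 :: ennreal)"
proof -
  interpret finite_measure \<nu> by (rule fin)
  \<comment> \<open>Testing the hypothesis on the set where the bound fails: the excess
    \<open>G - 1\<close> integrates to zero over it once \<open>emeasure \<nu> B\<close>, which is
    finite, is cancelled.\<close>
  define B where "B = {t \<in> space \<nu>. 1 < G t}"
  have B[measurable]: "B \<in> sets \<nu>" unfolding B_def by measurable
  have "(\<integral>\<^sup>+ t. (G t - 1) * indicator B t \<partial>\<nu>) + emeasure \<nu> B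
      = (\<integral>\<^sup>+ t. (G t - 1) * indicator B t + indicator B t \<partial>\<nu>)"
    by (subst nn_integral_add) auto
  also have "\<dots> = (\<integral>\<^sup>+ t. G t * indicator B t \<partial>\<nu>)"
    by (intro nn_integral_cong) (auto simp: B_def indicator_def less_imp_le diff_add_cancel_ennreal)
  also have "\<dots> \<le> 0 + emeasure \<nu> B" using le[OF B] by simp
  finally have "(\<integral>\<^sup>+ t. (G t - 1) * indicator B t \<partial>\<nu>) \<le> 0"
    using emeasure_finite[of B] by (simp add: ennreal_add_left_cancel_le add.commute top.not_eq_extremum)
  then have "AE t in \<nu>. (G t - 1) * indicator B t = 0"
    by (subst (asm) le_zero_eq, subst (asm) nn_integral_0_iff_AE) auto
  then show ?thesis
    using AE_space by eventually_elim (auto simp: B_def indicator_def ennreal_minus_eq_0 split: if_splits)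
qed

text \<open>A jointly measurable Radon-Nikodym derivative. Since \<open>N\<close> need not be countably generated, it
  cannot be obtained by differentiating on the product space and restricting to sections: the
  exceptional parameter set would depend on the test set \<open>B\<close>.\<close>

lemma section_densities_exist:
  assumes fin: "finite_measure \<rho>" and T[measurable]: "T \<in> \<rho> \<rightarrow>\<^sub>M N"
    and A: "A \<in> sets (W \<Otimes>\<^sub>M \<rho>)"
  shows "\<exists>G\<in>borel_measurable (W \<Otimes>\<^sub>M N). \<forall>w\<in>space W. \<forall>B\<in>sets N.
    emeasure \<rho> {y \<in> space \<rho>. (w, y) \<in> A \<and> T y \<in> B} =
      (\<integral>\<^sup>+ t. G (w, t) * indicator B t \<partial>distr \<rho> N T)"
proof -
  interpret finite_measure \<rho> by (rule fin)
  let ?\<nu> = "distr \<rho> N T"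
  interpret \<nu>: finite_measure ?\<nu> by (rule finite_measure_distr) simp
  have A': "A \<in> sigma_sets (space W \<times> space \<rho>) {a \<times> b | a b. a \<in> sets W \<and> b \<in> sets \<rho>}"
    using A by (simp add: sets_pair_measure)
  \<comment> \<open>A Dynkin argument starting from rectangles. Every step preserves the formula for
    all \<open>w\<close> and all \<open>B\<close> at once, so no exceptional set of parameters ever
    arises.\<close>
  show ?thesis
    using Int_stable_pair_measure_generator pair_measure_closed A'
  proof (induction rule: sigma_sets_induct_disjoint)
    case (basic A)
    then obtain a b where [simp]: "A = a \<times> b" and [measurable]: "a \<in> sets W" "b \<in> sets \<rho>" by auto
    \<comment> \<open>The section of \<open>a \<times> b\<close> at \<open>w\<close> is
      \<open>b\<close> or empty, so one derivative \<open>D\<close>, of the law of \<open>T\<close>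
      restricted to \<open>b\<close>, serves all \<open>w\<close>; the dependence on
      \<open>w\<close> is only \<open>indicator a w\<close>.\<close>
    let ?b = "distr (density \<rho> (indicator b)) N T"
    define D where "D = RN_deriv ?\<nu> ?b"
    have [measurable]: "D \<in> borel_measurable N" by (simp add: D_def borel_measurable_RN_deriv cong: measurable_cong_sets) 
    have ac: "absolutely_continuous ?\<nu> ?b"
      unfolding absolutely_continuous_def
    proof
      fix E assume E: "E \<in> null_sets ?\<nu>"
      then have [measurable]: "E \<in> sets N" by auto
      have "T -` E \<inter> space \<rho> \<in> null_sets \<rho>" using E by (simp add: null_sets_distr_iff)
      then have "AE y in \<rho>. T y \<notin> E" by (rule AE_I') auto
      then have "AE y in density \<rho> (indicator b). T y \<notin> E"
        by (auto simp: AE_density elim!: AE_mp)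
      then show "E \<in> null_sets ?b"
        by (simp add: AE_iff_null_sets AE_distr_iff)
    qed
    show ?case
    proof (intro bexI[of _ "\<lambda>(w, t). indicator a w * D t"] ballI)
      fix w B assume w[measurable]: "w \<in> space W" and B[measurable]: "B \<in> sets N"
      have "emeasure \<rho> {y \<in> space \<rho>. y \<in> b \<and> T y \<in> B} = emeasure \<rho> (b \<inter> (T -` B \<inter> space \<rho>))"
        by (intro arg_cong[where f = "emeasure \<rho>"]) auto
      also have "\<dots> = emeasure ?b B"
        by (simp add: emeasure_distr emeasure_density flip: indicator_inter_arith)
      also have "\<dots> = emeasure (density ?\<nu> D) B"
        using \<nu>.density_RN_deriv[OF ac] by (simp add: D_def)
      also have "\<dots> = (\<integral>\<^sup>+ t. D t * indicator B t \<partial>?\<nu>)"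
        by (simp add: emeasure_density)
      finally have "emeasure \<rho> {y \<in> space \<rho>. y \<in> b \<and> T y \<in> B} = (\<integral>\<^sup>+ t. D t * indicator B t \<partial>?\<nu>)" .
      then show "emeasure \<rho> {y \<in> space \<rho>. (w, y) \<in> A \<and> T y \<in> B} =
          (\<integral>\<^sup>+ t. (case (w, t) of (w, t) \<Rightarrow> indicator a w * D t) * indicator B t \<partial>?\<nu>)"
        by (auto simp: indicator_def)
    qed measurable
  next
    case empty
    show ?case by (intro bexI[of _ "\<lambda>_. 0"]) auto
  next
    case (compl A)
    then obtain G where [measurable]: "G \<in> borel_measurable (W \<Otimes>\<^sub>M N)"
      and G: "\<And>w B. w \<in> space W \<Longrightarrow> B \<in> sets N \<Longrightarrow>
        emeasure \<rho> {y \<in> space \<rho>. (w, y) \<in> A \<and> T y \<in> B} = (\<integral>\<^sup>+ t. G (w, t) * indicator B t \<partial>?\<nu>)"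
      by blast
    have As[measurable]: "A \<in> sets (W \<Otimes>\<^sub>M \<rho>)" using compl(1) by (simp add: sets_pair_measure)
    show ?case
    proof (intro bexI[of _ "\<lambda>z. 1 - G z"] ballI)
      fix w B assume w[measurable]: "w \<in> space W" and B[measurable]: "B \<in> sets N"
      have sec: "{y \<in> space \<rho>. (w, y) \<in> A \<and> T y \<in> E} \<in> sets \<rho>" if [measurable]: "E \<in> sets N" for E
        by measurable
      \<comment> \<open>Subtraction in \<open>ennreal\<close> is truncated at zero, so
        \<open>1 - G\<close> is a density of the complement only if \<open>G\<close> is at most 1
        almost everywhere.\<close>
      have le: "AE t in ?\<nu>. G (w, t) \<le> 1"
      proof (rule AE_le_one_of_set_integrals)
        show "finite_measure ?\<nu>" by unfold_locales
        show "(\<integral>\<^sup>+ t. G (w, t) * indicator E t \<partial>?\<nu>) \<le> emeasure ?\<nu> E" if E: "E \<in> sets ?\<nu>" for E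
          using E sec[of E] by (auto simp: G[symmetric] w emeasure_distr intro!: emeasure_mono)
      qed (use w in measurable)
      have "emeasure \<rho> {y \<in> space \<rho>. (w, y) \<in> space W \<times> space \<rho> - A \<and> T y \<in> B}
          = emeasure \<rho> ((T -` B \<inter> space \<rho>) - {y \<in> space \<rho>. (w, y) \<in> A \<and> T y \<in> B})"
        using w by (intro arg_cong[where f = "emeasure \<rho>"]) auto
      also have "\<dots> = emeasure ?\<nu> B - (\<integral>\<^sup>+ t. G (w, t) * indicator B t \<partial>?\<nu>)"
        using sec[OF B] by (subst emeasure_Diff) (auto simp: G[symmetric] w emeasure_distr)
      also have "\<dots> = (\<integral>\<^sup>+ t. indicator B t \<partial>?\<nu>) - (\<integral>\<^sup>+ t. G (w, t) * indicator B t \<partial>?\<nu>)"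
        by simp
      also have "\<dots> = (\<integral>\<^sup>+ t. indicator B t - G (w, t) * indicator B t \<partial>?\<nu>)"
      proof (rule nn_integral_diff[symmetric])
        show "(\<integral>\<^sup>+ t. G (w, t) * indicator B t \<partial>?\<nu>) \<noteq> \<infinity>"
          by (subst G[symmetric]) (use w in auto)
        show "AE t in ?\<nu>. G (w, t) * indicator B t \<le> indicator B t"
          using le by eventually_elim (auto simp: indicator_def)
      qed (use w in measurable)
      also have "\<dots> = (\<integral>\<^sup>+ t. (1 - G (w, t)) * indicator B t \<partial>?\<nu>)"
        by (intro nn_integral_cong) (auto simp: indicator_def)
      finally show "emeasure \<rho> {y \<in> space \<rho>. (w, y) \<in> space W \<times> space \<rho> - A \<and> T y \<in> B}
          = (\<integral>\<^sup>+ t. (1 - G (w, t)) * indicator B t \<partial>?\<nu>)" .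
    qed measurable
  next
    case (union A)
    then have "\<forall>n. \<exists>G. G \<in> borel_measurable (W \<Otimes>\<^sub>M N) \<and> (\<forall>w\<in>space W. \<forall>B\<in>sets N.
        emeasure \<rho> {y \<in> space \<rho>. (w, y) \<in> A n \<and> T y \<in> B} = (\<integral>\<^sup>+ t. G (w, t) * indicator B t \<partial>?\<nu>))"
      by blast
    from choice[OF this] obtain G where Gm[measurable]: "\<And>n. G n \<in> borel_measurable (W \<Otimes>\<^sub>M N)"
      and G: "\<And>n w B. w \<in> space W \<Longrightarrow> B \<in> sets N \<Longrightarrow>
        emeasure \<rho> {y \<in> space \<rho>. (w, y) \<in> A n \<and> T y \<in> B} = (\<integral>\<^sup>+ t. G n (w, t) * indicator B t \<partial>?\<nu>)"
      by blast
    have [measurable]: "A n \<in> sets (W \<Otimes>\<^sub>M \<rho>)" for n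
      using union(2) by (auto simp: sets_pair_measure)
    show ?case
    proof (intro bexI[of _ "\<lambda>z. \<Sum>n. G n z"] ballI)
      fix w B assume w[measurable]: "w \<in> space W" and B[measurable]: "B \<in> sets N"
      have "emeasure \<rho> {y \<in> space \<rho>. (w, y) \<in> (\<Union>n. A n) \<and> T y \<in> B}
          = emeasure \<rho> (\<Union>n. {y \<in> space \<rho>. (w, y) \<in> A n \<and> T y \<in> B})"
        by (intro arg_cong[where f = "emeasure \<rho>"]) auto
      also have "\<dots> = (\<Sum>n. emeasure \<rho> {y \<in> space \<rho>. (w, y) \<in> A n \<and> T y \<in> B})"
      proof (rule suminf_emeasure[symmetric])
        show "range (\<lambda>n. {y \<in> space \<rho>. (w, y) \<in> A n \<and> T y \<in> B}) \<subseteq> sets \<rho>"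
          by (intro image_subsetI) measurable
        show "disjoint_family (\<lambda>n. {y \<in> space \<rho>. (w, y) \<in> A n \<and> T y \<in> B})"
          using union(1) by (auto simp: disjoint_family_on_def)
      qed
      also have "\<dots> = (\<integral>\<^sup>+ t. (\<Sum>n. G n (w, t) * indicator B t) \<partial>?\<nu>)"
        using w by (subst nn_integral_suminf) (auto simp: G)
      finally show "emeasure \<rho> {y \<in> space \<rho>. (w, y) \<in> (\<Union>n. A n) \<and> T y \<in> B}
          = (\<integral>\<^sup>+ t. (\<Sum>n. G n (w, t)) * indicator B t \<partial>?\<nu>)"
        by (simp add: ennreal_suminf_multc)
    qed measurable
  qed
qed

text \<open>The set \<open>B\<close> in \<open>sec\<close> is chosen for each \<open>w\<close> on
  its own. The density \<open>G\<close> of the sections is measurable in \<open>(w, t)\<close> and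
  agrees for each \<open>w\<close> with the indicator of that \<open>B\<close> up to a null set, so
  its level set \<open>G = 1\<close> selects all these sets in a measurable way.\<close>

lemma sections_preimage_jointly:
  assumes fin: "finite_measure \<rho>" and T[measurable]: "T \<in> \<rho> \<rightarrow>\<^sub>M N"
    and A[measurable]: "A \<in> sets (W \<Otimes>\<^sub>M \<rho>)"
    and sec: "\<And>w. w \<in> space W \<Longrightarrow> \<exists>B\<in>sets N. AE y in \<rho>. (w, y) \<in> A \<longleftrightarrow> T y \<in> B"
  shows "\<exists>D\<in>sets (W \<Otimes>\<^sub>M N). \<forall>w\<in>space W. AE y in \<rho>. (w, y) \<in> A \<longleftrightarrow> (w, T y) \<in> D"
proof -
  interpret finite_measure \<rho> by (rule fin)
  let ?\<nu> = "distr \<rho> N T"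
  interpret \<nu>: finite_measure ?\<nu> by (rule finite_measure_distr) simp
  obtain G where [measurable]: "G \<in> borel_measurable (W \<Otimes>\<^sub>M N)"
    and G: "\<And>w B. w \<in> space W \<Longrightarrow> B \<in> sets N \<Longrightarrow>
      emeasure \<rho> {y \<in> space \<rho>. (w, y) \<in> A \<and> T y \<in> B} = (\<integral>\<^sup>+ t. G (w, t) * indicator B t \<partial>?\<nu>)"
    using section_densities_exist[OF fin T A] by blast
  define D where "D = {z \<in> space (W \<Otimes>\<^sub>M N). G z = 1}"
  have [measurable]: "D \<in> sets (W \<Otimes>\<^sub>M N)" unfolding D_def by measurable
  show ?thesis
  proof (intro bexI[of _ D] ballI)
    fix w assume w[measurable]: "w \<in> space W"
    obtain B where B[measurable]: "B \<in> sets N" and AB: "AE y in \<rho>. (w, y) \<in> A \<longleftrightarrow> T y \<in> B"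
      using sec[OF w] by blast
    have Gw[measurable]: "(\<lambda>t. G (w, t)) \<in> borel_measurable N" using w by measurable
    \<comment> \<open>If the section of \<open>A\<close> at \<open>w\<close> is a preimage under \<open>T\<close>, its density is an indicator function.\<close>
    have "density ?\<nu> (\<lambda>t. G (w, t)) = density ?\<nu> (indicator B)"
    proof (rule measure_eqI)
      fix E assume "E \<in> sets (density ?\<nu> (\<lambda>t. G (w, t)))"
      then have E[measurable]: "E \<in> sets N" by simp
      have "emeasure (density ?\<nu> (\<lambda>t. G (w, t))) E = emeasure \<rho> {y \<in> space \<rho>. (w, y) \<in> A \<and> T y \<in> E}"
        using w by (simp add: emeasure_density G)
      also have "\<dots> = emeasure \<rho> (T -` (B \<inter> E) \<inter> space \<rho>)"
        by (rule emeasure_eq_AE) (use AB w in \<open>auto elim!: AE_mp\<close>)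
      also have "\<dots> = emeasure (density ?\<nu> (indicator B)) E"
        by (simp add: emeasure_density emeasure_distr flip: indicator_inter_arith)
      finally show "emeasure (density ?\<nu> (\<lambda>t. G (w, t))) E = emeasure (density ?\<nu> (indicator B)) E" .
    qed simp
    then have "AE t in ?\<nu>. G (w, t) = indicator B t"
      by (subst (asm) \<nu>.density_unique_iff) auto
    then have "AE y in \<rho>. G (w, T y) = indicator B (T y)"
      by (subst (asm) AE_distr_iff) auto
    with AB AE_space show "AE y in \<rho>. (w, y) \<in> A \<longleftrightarrow> (w, T y) \<in> D"
    proof eventually_elim
      case (elim y)
      then show ?case using w measurable_space[OF T]
        by (auto simp: D_def space_pair_measure indicator_def split: if_splits)
    qed
  qed simp
qed

text \<open>A function is recovered from its superlevel sets, and the sections of these are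
  preimages under \<open>T\<close> because the sections of \<open>\<phi>\<close> are functions of
  \<open>T\<close>. Rational levels suffice, so for each \<open>w\<close> only countably many null
  sets have to be united.\<close>

lemma sections_through_statistic_jointly:
  fixes \<phi> :: "'w \<times> 'y \<Rightarrow> ennreal"
  assumes fin: "finite_measure \<rho>" and T[measurable]: "T \<in> \<rho> \<rightarrow>\<^sub>M N"
    and \<phi>[measurable]: "\<phi> \<in> borel_measurable (W \<Otimes>\<^sub>M \<rho>)"
    and sec: "\<And>w. w \<in> space W \<Longrightarrow> \<exists>k\<in>borel_measurable N. AE y in \<rho>. \<phi> (w, y) = k (T y)"
  shows "\<exists>G\<in>borel_measurable (W \<Otimes>\<^sub>M N). \<forall>w\<in>space W. AE y in \<rho>. \<phi> (w, y) = G (w, T y)"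
proof -
  let ?q = "\<lambda>q::rat. ennreal (of_rat q)"
  define A where "A q = {z \<in> space (W \<Otimes>\<^sub>M \<rho>). ?q q < \<phi> z}" for q
  have "\<exists>D. D \<in> sets (W \<Otimes>\<^sub>M N) \<and> (\<forall>w\<in>space W. AE y in \<rho>. (w, y) \<in> A q \<longleftrightarrow> (w, T y) \<in> D)" for q
    unfolding Bex_def[symmetric]
  proof (rule sections_preimage_jointly[OF fin T])
    show "A q \<in> sets (W \<Otimes>\<^sub>M \<rho>)" unfolding A_def by measurable
    fix w assume w: "w \<in> space W"
    then obtain k where [measurable]: "k \<in> borel_measurable N" and k: "AE y in \<rho>. \<phi> (w, y) = k (T y)"
      using sec by blast
    show "\<exists>B\<in>sets N. AE y in \<rho>. (w, y) \<in> A q \<longleftrightarrow> T y \<in> B"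
    proof (intro bexI[of _ "{t \<in> space N. ?q q < k t}"])
      show "AE y in \<rho>. (w, y) \<in> A q \<longleftrightarrow> T y \<in> {t \<in> space N. ?q q < k t}"
        using k AE_space
        by eventually_elim (use w measurable_space[OF T] in \<open>auto simp: A_def space_pair_measure\<close>)
    qed measurable
  qed
  then have "\<forall>q. \<exists>D. D \<in> sets (W \<Otimes>\<^sub>M N) \<and> (\<forall>w\<in>space W. AE y in \<rho>. (w, y) \<in> A q \<longleftrightarrow> (w, T y) \<in> D)"
    by blast
  from choice[OF this] obtain D where D[measurable]: "\<And>q. D q \<in> sets (W \<Otimes>\<^sub>M N)"
    and AD: "\<And>q w. w \<in> space W \<Longrightarrow> AE y in \<rho>. (w, y) \<in> A q \<longleftrightarrow> (w, T y) \<in> D q"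
    by blast
  \<comment> \<open>The sets \<open>D q\<close> are not nested in general. This does no harm: at
    almost every \<open>y\<close> membership of \<open>(w, T y)\<close> in \<open>D q\<close> means
    \<open>?q q < \<phi> (w, y)\<close> for all \<open>q\<close> at once, and there the supremum is
    \<open>\<phi> (w, y)\<close>.\<close>
  define G where "G z = (SUP q. if z \<in> D q then ?q q else 0)" for z
  have sup_below: "x = (SUP q. if ?q q < x then ?q q else 0)" for x :: ennreal
  proof (rule antisym)
    show "x \<le> (SUP q. if ?q q < x then ?q q else 0)"
    proof (rule dense_le)
      fix z assume "z < x"
      then obtain q where "z < ?q q" "?q q < x" using ennreal_rat_dense by blast
      then show "z \<le> (SUP q. if ?q q < x then ?q q else 0)"
        by (intro SUP_upper2[of q]) auto
    qed
    show "(SUP q. if ?q q < x then ?q q else 0) \<le> x"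
      by (intro SUP_least) (simp add: less_imp_le)
  qed
  show ?thesis
  proof (intro bexI[of _ G] ballI)
    fix w assume w: "w \<in> space W"
    have "AE y in \<rho>. \<forall>q. (w, y) \<in> A q \<longleftrightarrow> (w, T y) \<in> D q"
      using AD[OF w] by (simp add: AE_all_countable)
    with AE_space show "AE y in \<rho>. \<phi> (w, y) = G (w, T y)"
    proof eventually_elim
      case (elim y)
      then have "(w, T y) \<in> D q \<longleftrightarrow> ?q q < \<phi> (w, y)" for q
        using w by (auto simp: A_def space_pair_measure)
      then show ?case unfolding G_def by (subst sup_below) simp
    qed
  next
    show "G \<in> borel_measurable (W \<Otimes>\<^sub>M N)" unfolding G_def by measurable
  qed
qed

section \<open>Factorization through a statistic and its stability under integration\<close>

text \<open>The factor \<open>h\<close> is a parameter of the predicate because it has to be common to all members of a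
  family; \<open>k\<close> may be infinite, which is harmless where \<open>h = 0\<close>.\<close>

definition factors_through ::
  "'y measure \<Rightarrow> 't measure \<Rightarrow> ('y \<Rightarrow> 't) \<Rightarrow> ('y \<Rightarrow> real) \<Rightarrow> ('y \<Rightarrow> ennreal) \<Rightarrow> bool"
  where "factors_through M N T h f \<longleftrightarrow>
    (\<exists>k\<in>borel_measurable N. AE y in M. f y = ennreal (h y) * k (T y))"

text \<open>\<open>\<rho>\<close> has density \<open>u * indicator {h > 0}\<close> for a strictly
  positive integrable \<open>u\<close>. It makes the finite-measure lemmas applicable and ignores
  exactly the region where one cannot divide by \<open>h\<close>.\<close>

lemma equivalent_finite_density:
  assumes "sigma_finite_measure M" and [measurable]: "h \<in> borel_measurable M"
  obtains \<rho> where "finite_measure \<rho>" "sets \<rho> = sets M" "space \<rho> = space M"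
    "\<And>P. {y \<in> space M. P y} \<in> sets M \<Longrightarrow> (AE y in \<rho>. P y) \<longleftrightarrow> (AE y in M. (0::real) < h y \<longrightarrow> P y)"
    "\<And>P. (AE y in \<rho>. P y) \<Longrightarrow> (AE y in M. (0::real) < h y \<longrightarrow> P y)"
proof -
  interpret sigma_finite_measure M by fact
  obtain u where u[measurable]: "u \<in> borel_measurable M" and fin: "integral\<^sup>N M u \<noteq> \<infinity>"
    and pos: "\<And>y. y \<in> space M \<Longrightarrow> 0 < u y \<and> u y < \<infinity>"
    using Ex_finite_integrable_function by blast
  let ?u = "\<lambda>y. u y * indicator {y \<in> space M. 0 < h y} y"
  have *: "(AE y in density M ?u. P y) \<longleftrightarrow> (AE y in M. 0 < h y \<longrightarrow> P y)" for P
  proof -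
    have "(AE y in density M ?u. P y) \<longleftrightarrow> (AE y in M. 0 < ?u y \<longrightarrow> P y)"
      by (simp add: AE_density)
    also have "\<dots> \<longleftrightarrow> (AE y in M. 0 < h y \<longrightarrow> P y)"
      by (intro AE_cong) (use pos in \<open>auto simp: indicator_def\<close>)
    finally show ?thesis .
  qed
  have "finite_measure (density M ?u)"
  proof
    have "emeasure (density M ?u) (space M) \<le> integral\<^sup>N M u"
      by (subst emeasure_density) (auto intro!: nn_integral_mono simp: indicator_def)
    then show "emeasure (density M ?u) (space (density M ?u)) \<noteq> \<infinity>"
      using fin by (auto simp: top_unique)
  qed
  from that[OF this] * show thesis by simp
qed

text \<open>On \<open>{h > 0}\<close> the quotient \<open>f / h\<close> is jointly measurable and
  has sections that depend on \<open>y\<close> through \<open>T y\<close>, so the measurable choice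
  applies to it under \<open>\<rho>\<close>.\<close>

lemma factors_through_jointly:
  fixes f :: "'w \<times> 'y \<Rightarrow> ennreal"
  assumes M: "sigma_finite_measure M" and T[measurable]: "T \<in> M \<rightarrow>\<^sub>M N"
    and h[measurable]: "h \<in> borel_measurable M"
    and f[measurable]: "f \<in> borel_measurable (W \<Otimes>\<^sub>M M)"
    and fac: "\<And>w. w \<in> space W \<Longrightarrow> factors_through M N T h (\<lambda>y. f (w, y))"
  shows "\<exists>G\<in>borel_measurable (W \<Otimes>\<^sub>M N). \<forall>w\<in>space W. AE y in M. f (w, y) = ennreal (h y) * G (w, T y)"
proof -
  obtain \<rho> where fin: "finite_measure \<rho>" and sets[measurable_cong]: "sets \<rho> = sets M"
    and "space \<rho> = space M"
    and "\<And>P. {y \<in> space M. P y} \<in> sets M \<Longrightarrow> (AE y in \<rho>. P y) \<longleftrightarrow> (AE y in M. 0 < h y \<longrightarrow> P y)"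
    and AE1: "\<And>P. (AE y in \<rho>. P y) \<Longrightarrow> (AE y in M. 0 < h y \<longrightarrow> P y)"
    using equivalent_finite_density[OF M h] by blast
  note AE2 = this(4)
  define \<phi> where "\<phi> = (\<lambda>(w, y). f (w, y) / ennreal (h y))"
  have "\<exists>G\<in>borel_measurable (W \<Otimes>\<^sub>M N). \<forall>w\<in>space W. AE y in \<rho>. \<phi> (w, y) = G (w, T y)"
  proof (rule sections_through_statistic_jointly[OF fin])
    show "T \<in> \<rho> \<rightarrow>\<^sub>M N" by measurable
    show "\<phi> \<in> borel_measurable (W \<Otimes>\<^sub>M \<rho>)" unfolding \<phi>_def by measurable
    fix w assume w[measurable]: "w \<in> space W"
    obtain k where k[measurable]: "k \<in> borel_measurable N" and eq: "AE y in M. f (w, y) = ennreal (h y) * k (T y)"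
      using fac[OF w] unfolding factors_through_def by blast
    show "\<exists>k\<in>borel_measurable N. AE y in \<rho>. \<phi> (w, y) = k (T y)"
    proof (intro bexI[OF _ k], subst AE2)
      show "{y \<in> space M. \<phi> (w, y) = k (T y)} \<in> sets M" using w unfolding \<phi>_def by measurable
      show "AE y in M. 0 < h y \<longrightarrow> \<phi> (w, y) = k (T y)"
        using eq
      proof (eventually_elim, intro impI)
        fix y assume y: "f (w, y) = ennreal (h y) * k (T y)" "0 < h y"
        have "k (T y) * ennreal (h y) / ennreal (h y) = k (T y)"
          using y(2) by (intro ennreal_mult_divide_eq) auto
        then show "\<phi> (w, y) = k (T y)" by (simp add: \<phi>_def y(1) mult.commute)
      qed
    qed
  qed
  then obtain G where G[measurable]: "G \<in> borel_measurable (W \<Otimes>\<^sub>M N)"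
    and eq: "\<And>w. w \<in> space W \<Longrightarrow> AE y in \<rho>. \<phi> (w, y) = G (w, T y)" by blast
  show ?thesis
  proof (intro bexI[OF _ G] ballI)
    fix w assume w: "w \<in> space W"
    \<comment> \<open>The sectionwise factor is needed once more: it shows that \<open>f\<close>
      vanishes where \<open>h\<close> does, a region that \<open>\<rho>\<close> does not
      see.\<close>
    obtain k where "AE y in M. f (w, y) = ennreal (h y) * k (T y)"
      using fac[OF w] unfolding factors_through_def by blast
    then show "AE y in M. f (w, y) = ennreal (h y) * G (w, T y)"
      using AE1[OF eq[OF w]]
    proof eventually_elim
      case (elim y)
      show ?case
      proof (cases "0 < h y")
        case True
        have "k (T y) * ennreal (h y) / ennreal (h y) = k (T y)"
          using True by (intro ennreal_mult_divide_eq) auto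
        then have "G (w, T y) = k (T y)"
          using elim True by (simp add: \<phi>_def mult.commute)
        then show ?thesis by (simp add: elim(1))
      next
        case False
        then show ?thesis using elim(1) by (simp add: ennreal_neg)
      qed
    qed
  qed
qed

text \<open>The null set in \<open>eq\<close> may vary with \<open>w\<close>. By Fubini the two
  almost-everywhere quantifiers commute, so for almost every \<open>y\<close> the integrands agree
  for almost every \<open>w\<close>.\<close>

lemma AE_nn_integral_eq_of_sections:
  fixes f g :: "'w \<times> 'y \<Rightarrow> ennreal"
  assumes "sigma_finite_measure W" "sigma_finite_measure M"
    and [measurable]: "f \<in> borel_measurable (W \<Otimes>\<^sub>M M)" "g \<in> borel_measurable (W \<Otimes>\<^sub>M M)"
    and eq: "\<And>w. w \<in> space W \<Longrightarrow> AE y in M. f (w, y) = g (w, y)"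
  shows "AE y in M. (\<integral>\<^sup>+ w. f (w, y) \<partial>W) = (\<integral>\<^sup>+ w. g (w, y) \<partial>W)"
proof -
  interpret pair_sigma_finite W M using assms(1,2) by (rule pair_sigma_finite.intro)
  have "AE w in W. AE y in M. f (w, y) = g (w, y)" by (rule AE_I2) (rule eq)
  then have "AE y in M. AE w in W. f (w, y) = g (w, y)"
    by (subst (asm) AE_commute) auto
  then show ?thesis by eventually_elim (rule nn_integral_cong_AE)
qed

text \<open>With the jointly measurable \<open>G\<close> in place of the sectionwise factors,
  \<open>h\<close> leaves the integral, and what remains is a measurable function of
  \<open>T y\<close>. It is essential that \<open>h\<close> is the same for all
  \<open>w\<close>.\<close>

lemma factors_through_nn_integral:
  fixes f :: "'w \<times> 'y \<Rightarrow> ennreal"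
  assumes W: "sigma_finite_measure W" and M: "sigma_finite_measure M" and T[measurable]: "T \<in> M \<rightarrow>\<^sub>M N"
    and h[measurable]: "h \<in> borel_measurable M"
    and f[measurable]: "f \<in> borel_measurable (W \<Otimes>\<^sub>M M)"
    and fac: "\<And>w. w \<in> space W \<Longrightarrow> factors_through M N T h (\<lambda>y. f (w, y))"
  shows "factors_through M N T h (\<lambda>y. \<integral>\<^sup>+ w. f (w, y) \<partial>W)"
proof -
  interpret W: sigma_finite_measure W by fact
  obtain G where G[measurable]: "G \<in> borel_measurable (W \<Otimes>\<^sub>M N)"
    and eq: "\<And>w. w \<in> space W \<Longrightarrow> AE y in M. f (w, y) = ennreal (h y) * G (w, T y)"
    using factors_through_jointly[OF M T h f fac] by blast
  have "AE y in M. (\<integral>\<^sup>+ w. f (w, y) \<partial>W) = (\<integral>\<^sup>+ w. (case (w, y) of (w, y) \<Rightarrow> ennreal (h y) * G (w, T y)) \<partial>W)"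
    by (rule AE_nn_integral_eq_of_sections[OF W M f]) (auto simp: eq)
  then have "AE y in M. (\<integral>\<^sup>+ w. f (w, y) \<partial>W) = ennreal (h y) * (\<integral>\<^sup>+ w. G (w, T y) \<partial>W)"
    using AE_space
  proof eventually_elim
    case (elim y)
    then have [measurable]: "T y \<in> space N" using measurable_space[OF T] by simp
    show ?case using elim by (simp add: nn_integral_cmult)
  qed
  then show ?thesis unfolding factors_through_def
    by (intro bexI[of _ "\<lambda>t. \<integral>\<^sup>+ w. G (w, t) \<partial>W"]) measurable
qed

lemma factors_through_cong_AE:
  "AE y in M. f y = f' y \<Longrightarrow> factors_through M N T h f' \<Longrightarrow> factors_through M N T h f"
  unfolding factors_through_def by (auto elim!: bexI[rotated])

section \<open>Dominating measures and equality of likelihoods\<close>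

lemma equivalent_finite_measure:
  assumes "sigma_finite_measure M"
  obtains L where "finite_measure L" "sets L = sets M" "absolutely_continuous L M"
proof -
  define h :: "'a \<Rightarrow> real" where "h = (\<lambda>_. 1)"
  have h: "h \<in> borel_measurable M" by (simp add: h_def)
  obtain L where L: "finite_measure L" "sets L = sets M" and "space L = space M"
    and "\<And>P. {y \<in> space M. P y} \<in> sets M \<Longrightarrow> (AE y in L. P y) \<longleftrightarrow> (AE y in M. 0 < h y \<longrightarrow> P y)"
    and AE: "\<And>P. (AE y in L. P y) \<Longrightarrow> (AE y in M. 0 < h y \<longrightarrow> P y)"
    using equivalent_finite_density[OF assms h] by blast
  have "E \<in> null_sets M" if "E \<in> null_sets L" for E
    using AE[OF AE_not_in[OF that]] that L(2) unfolding h_def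
    by (subst AE_iff_null_sets) (auto simp: null_sets_def)
  then show thesis using that[OF L] by (auto simp: absolutely_continuous_def)
qed

text \<open>Likelihoods may be densities with respect to unrelated dominating measures; they can be
  compared only as densities with respect to one measure. Replacing both measures by finite ones
  before adding keeps the sum finite.\<close>

lemma common_dominating_measure:
  assumes A: "sigma_finite_measure A" and B: "sigma_finite_measure B" and sets: "sets A = sets B"
  obtains L where "finite_measure L" "sets L = sets A"
    "absolutely_continuous L A" "absolutely_continuous L B"
proof -
  obtain A' where A': "finite_measure A'" "sets A' = sets A" "absolutely_continuous A' A"
    using equivalent_finite_measure[OF A] by blast
  obtain B' where B': "finite_measure B'" "sets B' = sets B" "absolutely_continuous B' B"
    using equivalent_finite_measure[OF B] by blast
  interpret A': finite_measure A' by fact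
  interpret B': finite_measure B' by fact
  let ?L = "measure_of (space A) (sets A) (\<lambda>E. emeasure A' E + emeasure B' E)"
  have em: "emeasure ?L E = emeasure A' E + emeasure B' E" if "E \<in> sets A" for E
  proof (rule emeasure_measure_of[OF refl])
    show "sets A \<subseteq> Pow (space A)" by (rule sets.space_closed)
    show "E \<in> sets ?L" using that by simp
    show "positive (sets ?L) (\<lambda>E. emeasure A' E + emeasure B' E)"
      by (simp add: positive_def)
    show "countably_additive (sets ?L) (\<lambda>E. emeasure A' E + emeasure B' E)"
    proof (rule countably_additiveI)
      fix E :: "nat \<Rightarrow> 'a set" assume E: "range E \<subseteq> sets ?L" "disjoint_family E"
      have "range E \<subseteq> sets A" using E(1) by simp
      then have "range E \<subseteq> sets A'" "range E \<subseteq> sets B'" using A'(2) B'(2) sets by auto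
      with E(2) show "(\<Sum>i. emeasure A' (E i) + emeasure B' (E i)) = emeasure A' (\<Union>i. E i) + emeasure B' (\<Union>i. E i)"
        by (simp add: suminf_emeasure flip: suminf_add)
    qed
  qed
  show thesis
  proof
    show L: "sets ?L = sets A" by simp
    show "finite_measure ?L"
      by (rule finite_measureI) (simp add: em)
    have "E \<in> null_sets A' \<and> E \<in> null_sets B'" if "E \<in> null_sets ?L" for E
    proof -
      have E: "E \<in> sets A" using null_setsD2[OF that] by simp
      then have "emeasure A' E + emeasure B' E = 0" using null_setsD1[OF that] by (simp only: em)
      then show ?thesis using E A'(2) B'(2) sets by (intro conjI null_setsI) simp_all
    qed
    then show "absolutely_continuous ?L A" "absolutely_continuous ?L B"
      using A'(3) B'(3) unfolding absolutely_continuous_def by blast+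
  qed
qed

lemma distr_density_factor:
  assumes T[measurable]: "T \<in> M \<rightarrow>\<^sub>M N" and [measurable]: "h \<in> borel_measurable M" "f \<in> borel_measurable M"
    and [measurable]: "k \<in> borel_measurable N"
    and f: "AE y in M. f y = h y * k (T y)"
  shows "distr (density M f) N T = density (distr (density M h) N T) k"
proof (rule measure_eqI)
  fix E assume "E \<in> sets (distr (density M f) N T)"
  then have [measurable]: "E \<in> sets N" by simp
  have "emeasure (distr (density M f) N T) E = (\<integral>\<^sup>+ y. f y * indicator E (T y) \<partial>M)"
    by (auto simp: emeasure_distr emeasure_density indicator_def intro!: nn_integral_cong)
  also have "\<dots> = (\<integral>\<^sup>+ y. h y * (k (T y) * indicator E (T y)) \<partial>M)"
    using f by (intro nn_integral_cong_AE) (auto elim!: AE_mp simp: mult.assoc)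
  also have "\<dots> = emeasure (density (distr (density M h) N T) k) E"
    by (simp add: emeasure_density nn_integral_distr nn_integral_density)
  finally show "emeasure (distr (density M f) N T) E = emeasure (density (distr (density M h) N T) k) E" .
qed simp

lemma absolutely_continuousD_AE:
  assumes ac: "absolutely_continuous A B" and sets: "sets A = sets B" and P: "AE x in A. P x"
  shows "AE x in B. P x"
proof -
  obtain E where E: "{x \<in> space A. \<not> P x} \<subseteq> E" "E \<in> null_sets A"
    using P by (auto elim!: AE_E simp: null_sets_def)
  then have "E \<in> null_sets B" using ac by (auto simp: absolutely_continuous_def)
  then show ?thesis using E(1) sets_eq_imp_space_eq[OF sets] by (auto intro!: AE_I')
qed

text \<open>\<open>G\<close> is the density of \<open>H\<close>, the image of \<open>h\<close> times
  \<open>M\<close>, with respect to the finite measure \<open>\<nu>\<close>, so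
  \<open>G * k \<psi>\<close> is a likelihood based on \<open>T\<close>. Any other likelihood is
  matched with it under a common dominating measure, and the ratio of the two does not involve
  \<psi>.\<close>

lemma same_likelihood_of_factors_through:
  assumes M: "sigma_finite_measure M" and T[measurable]: "T \<in> M \<rightarrow>\<^sub>M N"
    and h[measurable]: "h \<in> borel_measurable M"
    and f: "\<And>\<psi>. \<psi> \<in> \<Psi> \<Longrightarrow> prob_density M (f \<psi>)"
    and fac: "\<And>\<psi>. \<psi> \<in> \<Psi> \<Longrightarrow> factors_through M N T h (f \<psi>)"
  shows "same_likelihood M N \<Psi> f T"
proof -
  interpret M: sigma_finite_measure M by fact
  have fm[measurable]: "f \<psi> \<in> borel_measurable M" if "\<psi> \<in> \<Psi>" for \<psi>
    using f[OF that] by (simp add: prob_density_def)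
  have "\<forall>\<psi>. \<exists>k. \<psi> \<in> \<Psi> \<longrightarrow> k \<in> borel_measurable N \<and> (AE y in M. f \<psi> y = ennreal (h y) * k (T y))"
    using fac unfolding factors_through_def by blast
  from choice[OF this] obtain k where k[measurable]: "\<And>\<psi>. \<psi> \<in> \<Psi> \<Longrightarrow> k \<psi> \<in> borel_measurable N"
    and fk: "\<And>\<psi>. \<psi> \<in> \<Psi> \<Longrightarrow> AE y in M. f \<psi> y = ennreal (h y) * k \<psi> (T y)" by blast
  obtain \<rho> where fin: "finite_measure \<rho>" and sets[measurable_cong]: "sets \<rho> = sets M"
    and sp: "space \<rho> = space M"
    and AE2: "\<And>P. {y \<in> space M. P y} \<in> sets M \<Longrightarrow> (AE y in \<rho>. P y) \<longleftrightarrow> (AE y in M. 0 < h y \<longrightarrow> P y)"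
    and AE1: "\<And>P. (AE y in \<rho>. P y) \<Longrightarrow> (AE y in M. 0 < h y \<longrightarrow> P y)"
    using equivalent_finite_density[OF M h] by blast
  interpret \<rho>: finite_measure \<rho> by fact
  define \<nu> where "\<nu> = distr \<rho> N T"
  interpret \<nu>: finite_measure \<nu> unfolding \<nu>_def by (rule \<rho>.finite_measure_distr) simp
  have s\<nu>[measurable_cong, simp]: "sets \<nu> = sets N" by (simp add: \<nu>_def)
  have pull: "AE y in M. 0 < h y \<longrightarrow> P (T y)" if "AE t in \<nu>. P t" for P
    by (rule AE1[OF AE_distrD[OF _ that[unfolded \<nu>_def]]]) simp
  define H where "H = distr (density M (\<lambda>y. ennreal (h y))) N T"
  have ac: "absolutely_continuous \<nu> H"
    unfolding absolutely_continuous_def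
  proof
    fix E assume E: "E \<in> null_sets \<nu>"
    then have [measurable]: "E \<in> sets N" by auto
    have "AE t in \<nu>. t \<notin> E" using E by (rule AE_not_in)
    from pull[OF this] have "AE y in density M (\<lambda>y. ennreal (h y)). T y \<notin> E"
      by (simp add: AE_density)
    then have "AE t in H. t \<notin> E" unfolding H_def by (subst AE_distr_iff) auto
    then show "E \<in> null_sets H" by (subst AE_iff_null_sets) (auto simp: H_def)
  qed
  define G where "G = RN_deriv \<nu> H"
  have G[measurable]: "G \<in> borel_measurable N"
    using borel_measurable_RN_deriv[of \<nu> H] by (simp add: G_def cong: measurable_cong_sets)
  have HG: "density \<nu> G = H" unfolding G_def
    by (rule \<nu>.density_RN_deriv[OF ac]) (simp add: H_def)
  have law: "distr (density M (f \<psi>)) N T = density \<nu> (\<lambda>t. G t * k \<psi> t)" if \<psi>: "\<psi> \<in> \<Psi>" for \<psi>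
  proof -
    note [measurable] = k[OF \<psi>] fm[OF \<psi>]
    have "distr (density M (f \<psi>)) N T = density H (k \<psi>)"
      unfolding H_def by (rule distr_density_factor) (use fk[OF \<psi>] in auto)
    then show ?thesis unfolding HG[symmetric] by (subst (asm) density_density_eq) auto
  qed
  \<comment> \<open>A density is positive almost everywhere under the measure it defines; this is
    pulled back from \<open>H\<close> to the data with \<open>h y > 0\<close>.\<close>
  have G_pos: "AE y in M. 0 < h y \<longrightarrow> 0 < G (T y)"
  proof -
    have "AE t in density \<nu> G. 0 < G t" by (subst AE_density) auto
    then have "AE y in density M (\<lambda>y. ennreal (h y)). 0 < G (T y)"
      unfolding HG H_def by (subst (asm) AE_distr_iff) auto
    then show ?thesis by (simp add: AE_density)
  qed
  \<comment> \<open>\<open>H\<close> may fail to be sigma-finite, so \<open>G\<close> itself may be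
    infinite. The total mass 1 bounds \<open>G * k \<psi>\<close>, which makes \<open>G\<close>
    finite wherever \<open>k \<psi>\<close> is positive.\<close>
  have Gk_fin: "AE t in \<nu>. G t * k \<psi> t \<noteq> \<infinity>" if \<psi>: "\<psi> \<in> \<Psi>" for \<psi>
  proof (rule nn_integral_PInf_AE)
    note [measurable] = k[OF \<psi>] fm[OF \<psi>]
    show "(\<lambda>t. G t * k \<psi> t) \<in> borel_measurable \<nu>" by measurable
    have "(\<integral>\<^sup>+ t. G t * k \<psi> t \<partial>\<nu>) = emeasure (density \<nu> (\<lambda>t. G t * k \<psi> t)) (space N)"
      by (subst emeasure_density) (auto intro!: nn_integral_cong simp: \<nu>_def)
    also have "\<dots> = emeasure (density M (f \<psi>)) (space M)"
      unfolding law[OF \<psi>, symmetric]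
      using measurable_space[OF T] by (subst emeasure_distr) (auto intro!: arg_cong2[where f = emeasure])
    also have "\<dots> = (\<integral>\<^sup>+ y. f \<psi> y \<partial>M)" by (subst emeasure_density) (auto intro!: nn_integral_cong)
    also have "\<dots> = 1" using f[OF \<psi>] by (simp add: prob_density_def)
    finally show "(\<integral>\<^sup>+ t. G t * k \<psi> t \<partial>\<nu>) \<noteq> \<infinity>" by simp
  qed
  have "statistic_likelihood M N \<Psi> f T (\<lambda>\<psi> t. G t * k \<psi> t)"
    unfolding statistic_likelihood_def
    by (intro exI[of _ \<nu>] conjI ballI law) (auto intro: \<nu>.sigma_finite_measure_axioms)
  moreover have "\<exists>c :: 'a \<Rightarrow> real. c \<in> borel_measurable M \<and> (\<forall>y. 0 < c y) \<and>
      (\<forall>\<psi>\<in>\<Psi>. \<forall>\<psi>'\<in>\<Psi>. AE y in density M (f \<psi>'). f \<psi> y = ennreal (c y) * L \<psi> (T y))"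
    if L: "statistic_likelihood M N \<Psi> f T L" for L
  proof -
    obtain \<nu>' where \<nu>': "sigma_finite_measure \<nu>'" and s\<nu>'[measurable_cong, simp]: "sets \<nu>' = sets N"
      and Lm[measurable]: "\<And>\<psi>. \<psi> \<in> \<Psi> \<Longrightarrow> L \<psi> \<in> borel_measurable N"
      and Ll: "\<And>\<psi>. \<psi> \<in> \<Psi> \<Longrightarrow> distr (density M (f \<psi>)) N T = density \<nu>' (L \<psi>)"
      using L unfolding statistic_likelihood_def by blast
    obtain \<Lambda> where \<Lambda>: "finite_measure \<Lambda>" and s\<Lambda>[measurable_cong, simp]: "sets \<Lambda> = sets N"
      and ac1: "absolutely_continuous \<Lambda> \<nu>" and ac2: "absolutely_continuous \<Lambda> \<nu>'"
      using common_dominating_measure[OF \<nu>.sigma_finite_measure_axioms \<nu>'] by auto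
    interpret \<Lambda>: finite_measure \<Lambda> by fact
    define a where "a = RN_deriv \<Lambda> \<nu>"
    define b where "b = RN_deriv \<Lambda> \<nu>'"
    have [measurable]: "a \<in> borel_measurable N" "b \<in> borel_measurable N"
      using borel_measurable_RN_deriv[of \<Lambda> \<nu>] borel_measurable_RN_deriv[of \<Lambda> \<nu>']
      by (simp_all add: a_def b_def cong: measurable_cong_sets)
    have a: "density \<Lambda> a = \<nu>" and b: "density \<Lambda> b = \<nu>'"
      unfolding a_def b_def by (rule \<Lambda>.density_RN_deriv; simp add: ac1 ac2)+
    have "AE t in \<Lambda>. a t \<noteq> \<infinity>" "AE t in \<Lambda>. b t \<noteq> \<infinity>"
      unfolding a_def b_def
      by (rule \<Lambda>.RN_deriv_finite; simp add: ac1 ac2 \<nu>' \<nu>.sigma_finite_measure_axioms)+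
    then have fin_ab: "AE t in \<nu>. a t \<noteq> \<infinity> \<and> b t \<noteq> \<infinity>"
      by (intro absolutely_continuousD_AE[OF ac1]) auto
    have a_pos: "AE t in \<nu>. 0 < a t" unfolding a[symmetric] by (subst AE_density) auto
    have eq: "AE t in \<nu>. a t * (G t * k \<psi> t) = b t * L \<psi> t" if \<psi>: "\<psi> \<in> \<Psi>" for \<psi>
    proof (rule absolutely_continuousD_AE[OF ac1])
      note [measurable] = k[OF \<psi>] Lm[OF \<psi>]
      have "density \<Lambda> (\<lambda>t. a t * (G t * k \<psi> t)) = density \<Lambda> (\<lambda>t. b t * L \<psi> t)"
        using law[OF \<psi>] Ll[OF \<psi>] unfolding a[symmetric] b[symmetric]
        by (simp add: density_density_eq)
      then show "AE t in \<Lambda>. a t * (G t * k \<psi> t) = b t * L \<psi> t"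
        by (subst (asm) \<Lambda>.density_unique_iff) auto
    qed simp
    \<comment> \<open>\<open>a\<close> and \<open>b\<close> being the densities of \<open>\<nu>\<close> and \<open>\<nu>'\<close> and \<open>G\<close> that of \<open>T\<^sub>*(h M)\<close>, \<open>eq\<close> gives
      \<open>f \<psi> = h * k \<psi> (T y) = h * b / (a * G) * L \<psi> (T y)\<close>.\<close>
    define d where "d y = ennreal (h y) * (b (T y) / (a (T y) * G (T y)))" for y
    have [measurable]: "d \<in> borel_measurable M" unfolding d_def by measurable
    \<comment> \<open>Outside the data that are possible under the model \<open>d\<close> can be 0
      or infinite, whereas \<open>c\<close> must be positive and real everywhere; the value 1 there
      is arbitrary.\<close>
    define c where "c y = (if d y = 0 \<or> d y = \<infinity> then 1 else enn2real (d y))" for y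
    show ?thesis
    proof (intro exI[of _ c] conjI ballI allI)
      show "c \<in> borel_measurable M" unfolding c_def by measurable
      show "0 < c y" for y by (auto simp: c_def enn2real_positive_iff top.not_eq_extremum zero_less_iff_neq_zero)
      fix \<psi> \<psi>' assume \<psi>: "\<psi> \<in> \<Psi>" and \<psi>': "\<psi>' \<in> \<Psi>"
      have "AE y in M. 0 < f \<psi>' y \<longrightarrow> f \<psi> y = ennreal (c y) * L \<psi> (T y)"
        using fk[OF \<psi>] fk[OF \<psi>'] G_pos pull[OF Gk_fin[OF \<psi>']] pull[OF fin_ab] pull[OF a_pos]
          pull[OF eq[OF \<psi>]] pull[OF eq[OF \<psi>']]
      proof (eventually_elim, intro impI)
        fix y assume f: "f \<psi> y = ennreal (h y) * k \<psi> (T y)" and f': "f \<psi>' y = ennreal (h y) * k \<psi>' (T y)"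
          and G0: "0 < h y \<longrightarrow> 0 < G (T y)"
          and Gk: "0 < h y \<longrightarrow> G (T y) * k \<psi>' (T y) \<noteq> \<infinity>"
          and ab: "0 < h y \<longrightarrow> a (T y) \<noteq> \<infinity> \<and> b (T y) \<noteq> \<infinity>" and a0: "0 < h y \<longrightarrow> 0 < a (T y)"
          and e: "0 < h y \<longrightarrow> a (T y) * (G (T y) * k \<psi> (T y)) = b (T y) * L \<psi> (T y)"
          and e': "0 < h y \<longrightarrow> a (T y) * (G (T y) * k \<psi>' (T y)) = b (T y) * L \<psi>' (T y)"
          and pos: "0 < f \<psi>' y"
        have h: "0 < h y" using pos f' by (cases "0 < h y") (auto simp: ennreal_neg)
        have k': "0 < k \<psi>' (T y)" using pos f' by (auto simp: zero_less_iff_neq_zero)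
        have G: "0 < G (T y)" "G (T y) \<noteq> \<infinity>"
          using G0 Gk h k' by (auto simp: ennreal_mult_eq_top_iff)
        define p where "p = a (T y) * G (T y)"
        have p: "p \<noteq> 0" "p \<noteq> \<infinity>"
          using G ab a0 h by (auto simp: p_def ennreal_mult_eq_top_iff)
        \<comment> \<open>Positivity of the density at \<psi>' is what excludes
          \<open>b (T y) = 0\<close>: the identity \<open>e'\<close> has a nonzero left
          side.\<close>
        have "b (T y) * L \<psi>' (T y) \<noteq> 0" using e' h k' p by (auto simp: p_def)
        then have b0: "b (T y) \<noteq> 0" by auto
        have bp: "b (T y) / p \<noteq> 0" "b (T y) / p \<noteq> \<infinity>"
          using b0 p ab h by (auto simp: ennreal_divide_eq_0_iff ennreal_divide_eq_top_iff)
        have "d y = ennreal (h y) * (b (T y) / p)" by (simp add: d_def p_def)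
        with bp h have d: "d y \<noteq> 0" "d y \<noteq> \<infinity>" by (auto simp: ennreal_mult_eq_top_iff)
        then have c: "ennreal (c y) = d y" by (simp add: c_def top.not_eq_extremum)
        have "k \<psi> (T y) = k \<psi> (T y) * p / p" using p by (simp add: ennreal_mult_divide_eq)
        also have "k \<psi> (T y) * p = b (T y) * L \<psi> (T y)" using e h by (simp add: p_def ac_simps)
        finally have "k \<psi> (T y) = b (T y) / p * L \<psi> (T y)"
          by (simp add: divide_ennreal_def ac_simps)
        then show "f \<psi> y = ennreal (c y) * L \<psi> (T y)"
          unfolding c d_def p_def[symmetric] f by (simp add: ac_simps)
      qed
      then show "AE y in density M (f \<psi>'). f \<psi> y = ennreal (c y) * L \<psi> (T y)"
        using \<psi>' by (simp add: AE_density)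
    qed
  qed
  ultimately show ?thesis unfolding same_likelihood_def using T by blast
qed

section \<open>Versions of the posterior distribution\<close>

text \<open>For fixed \<open>B\<close>, the defining identity says that
  \<open>\<lambda>d. emeasure (K d) B\<close> is a density of
  \<open>A \<mapsto> J (B \<times> A)\<close> with respect to the marginal law of the data, and
  densities over a finite measure are unique. The null set depends on \<open>B\<close>.\<close>

lemma posterior_version_unique:
  assumes J: "finite_measure J" and sJ[measurable_cong]: "sets J = sets (R \<Otimes>\<^sub>M D)"
    and K: "posterior_version J R D K" and K': "posterior_version J R D K'" and B[measurable]: "B \<in> sets R"
  shows "AE d in distr J D snd. emeasure (K d) B = emeasure (K' d) B"
proof -
  interpret J: finite_measure J by fact
  let ?D = "distr J D snd"
  have [measurable]: "snd \<in> J \<rightarrow>\<^sub>M D" by measurable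
  interpret D: finite_measure ?D by (rule J.finite_measure_distr) measurable
  have m[measurable]: "(\<lambda>d. emeasure (k d) B) \<in> borel_measurable D" if "posterior_version J R D k" for k
    using that B unfolding posterior_version_def
    by (auto intro: measurable_compose[OF measurable_prob_algebraD measurable_emeasure_subprob_algebra])
  have "density ?D (\<lambda>d. emeasure (K d) B) = density ?D (\<lambda>d. emeasure (K' d) B)"
  proof (rule measure_eqI)
    fix A assume "A \<in> sets (density ?D (\<lambda>d. emeasure (K d) B))"
    then have A[measurable]: "A \<in> sets D" by simp
    show "emeasure (density ?D (\<lambda>d. emeasure (K d) B)) A = emeasure (density ?D (\<lambda>d. emeasure (K' d) B)) A"
      using K K' A B m[OF K] m[OF K'] by (simp add: emeasure_density posterior_version_def)
  qed simp
  then show ?thesis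
    by (subst (asm) D.density_unique_iff) (use m[OF K] m[OF K'] in auto)
qed

lemma posterior_version_statistic:
  assumes sJ[measurable_cong]: "sets J = sets (R \<Otimes>\<^sub>M D)" and T[measurable]: "T \<in> D \<rightarrow>\<^sub>M N"
    and K[measurable]: "K \<in> N \<rightarrow>\<^sub>M prob_algebra R"
    and KT: "posterior_version J R D (\<lambda>d. K (T d))"
  shows "posterior_version (distr J (R \<Otimes>\<^sub>M N) (\<lambda>(\<theta>, d). (\<theta>, T d))) R N K"
  unfolding posterior_version_def
proof (intro conjI ballI K)
  fix B A assume B[measurable]: "B \<in> sets R" and A[measurable]: "A \<in> sets N"
  have m[measurable]: "(\<lambda>t. emeasure (K t) B) \<in> borel_measurable N"
    using measurable_compose[OF measurable_prob_algebraD[OF K] measurable_emeasure_subprob_algebra[OF B]] .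
  have sp: "space J = space R \<times> space D" using sets_eq_imp_space_eq[OF sJ] by (simp add: space_pair_measure)
  have "emeasure (distr J (R \<Otimes>\<^sub>M N) (\<lambda>(\<theta>, d). (\<theta>, T d))) (B \<times> A) = emeasure J (B \<times> (T -` A \<inter> space D))"
    using sets.sets_into_space[OF B] by (subst emeasure_distr) (auto intro!: arg_cong2[where f = emeasure] simp: sp)
  also have "\<dots> = (\<integral>\<^sup>+ d. emeasure (K (T d)) B * indicator (T -` A \<inter> space D) d \<partial>distr J D snd)"
    using KT B measurable_sets[OF T A] unfolding posterior_version_def by blast
  also have "\<dots> = (\<integral>\<^sup>+ d. emeasure (K (T d)) B * indicator A (T d) \<partial>distr J D snd)"
    by (intro nn_integral_cong) (auto simp: indicator_def)
  also have "\<dots> = (\<integral>\<^sup>+ t. emeasure (K t) B * indicator A t \<partial>distr (distr J D snd) N T)"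
    by (simp add: nn_integral_distr)
  also have "distr (distr J D snd) N T = distr (distr J (R \<Otimes>\<^sub>M N) (\<lambda>(\<theta>, d). (\<theta>, T d))) N snd"
    by (subst (1 2) distr_distr) (auto intro!: distr_cong)
  finally show "emeasure (distr J (R \<Otimes>\<^sub>M N) (\<lambda>(\<theta>, d). (\<theta>, T d))) (B \<times> A) =
    (\<integral>\<^sup>+ t. emeasure (K t) B * indicator A t \<partial>distr (distr J (R \<Otimes>\<^sub>M N) (\<lambda>(\<theta>, d). (\<theta>, T d))) N snd)" .
qed

text \<open>A single kernel \<open>K\<close> yields versions for both data, namely
  \<open>K (T d)\<close> and \<open>K t\<close>, and these are equal as measures. Uniqueness for
  each event carries the agreement over to arbitrary versions.\<close>

lemma same_posterior_if_kernel_of_statistic: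
  assumes J: "finite_measure J" and sJ[measurable_cong]: "sets J = sets (R \<Otimes>\<^sub>M D)" and T[measurable]: "T \<in> D \<rightarrow>\<^sub>M N"
    and K[measurable]: "K \<in> N \<rightarrow>\<^sub>M prob_algebra R"
    and KT: "posterior_version J R D (\<lambda>d. K (T d))"
  shows "same_posterior J R D N T"
proof -
  interpret J: finite_measure J by fact
  let ?JT = "distr J (R \<Otimes>\<^sub>M N) (\<lambda>(\<theta>, d). (\<theta>, T d))"
  have JT: "posterior_version ?JT R N K" by (rule posterior_version_statistic[OF sJ T K KT])
  have eq: "distr ?JT N snd = distr (distr J D snd) N T"
    by (subst (1 2) distr_distr) (auto intro!: distr_cong)
  have fin: "finite_measure ?JT" by (rule J.finite_measure_distr) measurable
  have "AE d in distr J D snd. emeasure (KY d) B = emeasure (KT (T d)) B"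
    if KY: "posterior_version J R D KY" and KT': "posterior_version ?JT R N KT" and B: "B \<in> sets R" for KY KT B
  proof -
    have "AE t in distr (distr J D snd) N T. emeasure (K t) B = emeasure (KT t) B"
      by (rule posterior_version_unique[OF fin sets_distr JT KT' B, unfolded eq])
    then have "AE d in distr J D snd. emeasure (K (T d)) B = emeasure (KT (T d)) B"
      by (rule AE_distrD[rotated]) simp
    with posterior_version_unique[OF J sJ KY KT B] show ?thesis
      by eventually_elim simp
  qed
  then show ?thesis
    unfolding same_posterior_def Let_def using T KT JT
    by (auto intro!: exI[of _ "\<lambda>d. K (T d)"] exI[of _ K])
qed

text \<open>Bayes' formula with prior \<open>R\<close> and likelihood \<open>G\<close>. The
  conclusion is multiplied out by the normalizing integral, so it also covers the value 0, where the
  integral over \<open>B\<close> vanishes as well.\<close>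

lemma normalized_kernel:
  assumes R: "prob_space R" and G[measurable]: "G \<in> borel_measurable (R \<Otimes>\<^sub>M N)"
  obtains K where "K \<in> N \<rightarrow>\<^sub>M prob_algebra R"
    "\<And>t B. t \<in> space N \<Longrightarrow> B \<in> sets R \<Longrightarrow> (\<integral>\<^sup>+ \<theta>. G (\<theta>, t) \<partial>R) \<noteq> \<infinity> \<Longrightarrow>
      (\<integral>\<^sup>+ \<theta>. G (\<theta>, t) \<partial>R) * emeasure (K t) B = (\<integral>\<^sup>+ \<theta>. G (\<theta>, t) * indicator B \<theta> \<partial>R)"
proof -
  interpret R: prob_space R by fact
  define Z where "Z t = (\<integral>\<^sup>+ \<theta>. G (\<theta>, t) \<partial>R)" for t
  have Z[measurable]: "Z \<in> borel_measurable N" unfolding Z_def by measurable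
  define good where "good t \<longleftrightarrow> Z t \<noteq> 0 \<and> Z t \<noteq> \<infinity>" for t
  have good[measurable]: "Measurable.pred N good" unfolding good_def by measurable
  \<comment> \<open>Where normalization is impossible, the prior is used so that \<open>K\<close>
    stays a probability kernel on all of \<open>N\<close>.\<close>
  define K where "K t = (if good t then density R (\<lambda>\<theta>. G (\<theta>, t) / Z t) else R)" for t
  have em: "emeasure (density R (\<lambda>\<theta>. G (\<theta>, t) / Z t)) B = (\<integral>\<^sup>+ \<theta>. G (\<theta>, t) * indicator B \<theta> \<partial>R) / Z t"
    if t[measurable]: "t \<in> space N" and B[measurable]: "B \<in> sets R" for t B
  proof -
    have "emeasure (density R (\<lambda>\<theta>. G (\<theta>, t) / Z t)) B = (\<integral>\<^sup>+ \<theta>. G (\<theta>, t) * indicator B \<theta> / Z t \<partial>R)"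
      by (subst emeasure_density) (auto simp: divide_ennreal_def ac_simps)
    also have "\<dots> = (\<integral>\<^sup>+ \<theta>. G (\<theta>, t) * indicator B \<theta> \<partial>R) / Z t"
      by (rule nn_integral_divide) measurable
    finally show ?thesis .
  qed
  show thesis
  proof
    have prob: "prob_space (K t)" if t[measurable]: "t \<in> space N" for t
    proof (cases "good t")
      case True
      have "(\<integral>\<^sup>+ \<theta>. G (\<theta>, t) * indicator (space R) \<theta> \<partial>R) = Z t"
        unfolding Z_def by (intro nn_integral_cong) auto
      then have "emeasure (density R (\<lambda>\<theta>. G (\<theta>, t) / Z t)) (space R) = 1"
        using True by (simp add: em t good_def ennreal_divide_self top.not_eq_extremum zero_less_iff_neq_zero)
      then show ?thesis using True by (auto simp: K_def intro!: prob_spaceI)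
    next
      case False
      then show ?thesis using R by (simp add: K_def)
    qed
    have Km: "(\<lambda>t. emeasure (K t) B) \<in> borel_measurable N" if B[measurable]: "B \<in> sets R" for B
    proof -
      have "(\<lambda>t. if good t then (\<integral>\<^sup>+ \<theta>. G (\<theta>, t) * indicator B \<theta> \<partial>R) / Z t else emeasure R B) \<in> borel_measurable N"
        by measurable
      then show ?thesis
        by (rule measurable_cong[THEN iffD1, rotated]) (simp add: K_def em)
    qed
    show "K \<in> N \<rightarrow>\<^sub>M prob_algebra R"
    proof (intro measurable_prob_algebraI measurable_subprob_algebra prob Km)
      show "subprob_space (K t)" if "t \<in> space N" for t
        using prob[OF that] by (rule prob_space_imp_subprob_space)
      show "sets (K t) = sets R" for t by (simp add: K_def)
    qed
    fix t B assume t[measurable]: "t \<in> space N" and B[measurable]: "B \<in> sets R"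
      and fin: "(\<integral>\<^sup>+ \<theta>. G (\<theta>, t) \<partial>R) \<noteq> \<infinity>"
    let ?I = "\<integral>\<^sup>+ \<theta>. G (\<theta>, t) * indicator B \<theta> \<partial>R"
    have le: "?I \<le> Z t" unfolding Z_def by (intro nn_integral_mono) (auto simp: indicator_def)
    have "Z t * emeasure (K t) B = ?I"
    proof (cases "Z t = 0")
      case True
      then show ?thesis using le by simp
    next
      case False
      then have "good t" using fin by (simp add: good_def Z_def)
      then have "emeasure (K t) B = ?I / Z t" by (simp add: K_def em t B)
      then have "Z t * emeasure (K t) B = ?I * Z t / Z t" by (simp add: divide_ennreal_def ac_simps)
      also have "\<dots> = ?I" using False fin by (intro ennreal_mult_divide_eq) (auto simp: Z_def)
      finally show ?thesis .
    qed
    then show "(\<integral>\<^sup>+ \<theta>. G (\<theta>, t) \<partial>R) * emeasure (K t) B = ?I" by (simp add: Z_def)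
  qed
qed

text \<open>The measurable choice is applied with \<theta> as the section parameter. The factor
  \<open>h y\<close> then cancels between the joint density and the marginal density
  \<open>h y * Z (T y)\<close> of the data, leaving a kernel that depends on
  \<open>T y\<close>.\<close>

lemma same_posterior_of_factors_through:
  fixes p :: "'theta \<times> 'y \<Rightarrow> ennreal"
  assumes R: "prob_space R" and M: "sigma_finite_measure M" and T[measurable]: "T \<in> M \<rightarrow>\<^sub>M N"
    and h[measurable]: "h \<in> borel_measurable M"
    and p[measurable]: "p \<in> borel_measurable (R \<Otimes>\<^sub>M M)"
    and p1: "\<And>\<theta>. \<theta> \<in> space R \<Longrightarrow> (\<integral>\<^sup>+ y. p (\<theta>, y) \<partial>M) = 1"
    and fac: "\<And>\<theta>. \<theta> \<in> space R \<Longrightarrow> factors_through M N T h (\<lambda>y. p (\<theta>, y))"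
  shows "same_posterior (density (R \<Otimes>\<^sub>M M) p) R M N T"
proof -
  interpret R: prob_space R by fact
  interpret M: sigma_finite_measure M by fact
  interpret RM: pair_sigma_finite R M ..
  let ?J = "density (R \<Otimes>\<^sub>M M) p"
  obtain G where G[measurable]: "G \<in> borel_measurable (R \<Otimes>\<^sub>M N)"
    and eq: "\<And>\<theta>. \<theta> \<in> space R \<Longrightarrow> AE y in M. p (\<theta>, y) = ennreal (h y) * G (\<theta>, T y)"
    using factors_through_jointly[OF M T h p fac] by blast
  define Z where "Z t = (\<integral>\<^sup>+ \<theta>. G (\<theta>, t) \<partial>R)" for t
  have [measurable]: "Z \<in> borel_measurable N" unfolding Z_def by measurable
  obtain K where K[measurable]: "K \<in> N \<rightarrow>\<^sub>M prob_algebra R"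
    and ZK: "\<And>t B. t \<in> space N \<Longrightarrow> B \<in> sets R \<Longrightarrow> Z t \<noteq> \<infinity> \<Longrightarrow>
      Z t * emeasure (K t) B = (\<integral>\<^sup>+ \<theta>. G (\<theta>, t) * indicator B \<theta> \<partial>R)"
    using normalized_kernel[OF R G] unfolding Z_def by blast
  have J_rect: "emeasure ?J (B \<times> A)
      = (\<integral>\<^sup>+ y. ennreal (h y) * (\<integral>\<^sup>+ \<theta>. G (\<theta>, T y) * indicator B \<theta> \<partial>R) * indicator A y \<partial>M)"
    if B[measurable]: "B \<in> sets R" and A[measurable]: "A \<in> sets M" for A B
  proof -
    have "emeasure ?J (B \<times> A) = (\<integral>\<^sup>+ y. (\<integral>\<^sup>+ \<theta>. p (\<theta>, y) * indicator (B \<times> A) (\<theta>, y) \<partial>R) \<partial>M)"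
      by (subst emeasure_density, measurable, subst RM.nn_integral_snd[symmetric]) auto
    also have "\<dots> = (\<integral>\<^sup>+ y. (\<integral>\<^sup>+ \<theta>. ennreal (h y) * G (\<theta>, T y) * indicator B \<theta> * indicator A y \<partial>R) \<partial>M)"
    proof (rule nn_integral_cong_AE)
      have "AE y in M. (\<integral>\<^sup>+ \<theta>. (\<lambda>(\<theta>, y). p (\<theta>, y) * indicator (B \<times> A) (\<theta>, y)) (\<theta>, y) \<partial>R)
        = (\<integral>\<^sup>+ \<theta>. (\<lambda>(\<theta>, y). ennreal (h y) * G (\<theta>, T y) * indicator B \<theta> * indicator A y) (\<theta>, y) \<partial>R)"
      proof (rule AE_nn_integral_eq_of_sections[OF R.sigma_finite_measure_axioms M])
        fix \<theta> assume "\<theta> \<in> space R"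
        from eq[OF this] show "AE y in M. (\<lambda>(\<theta>, y). p (\<theta>, y) * indicator (B \<times> A) (\<theta>, y)) (\<theta>, y)
            = (\<lambda>(\<theta>, y). ennreal (h y) * G (\<theta>, T y) * indicator B \<theta> * indicator A y) (\<theta>, y)"
          by eventually_elim (auto simp: indicator_def)
      qed measurable
      then show "AE y in M. (\<integral>\<^sup>+ \<theta>. p (\<theta>, y) * indicator (B \<times> A) (\<theta>, y) \<partial>R)
        = (\<integral>\<^sup>+ \<theta>. ennreal (h y) * G (\<theta>, T y) * indicator B \<theta> * indicator A y \<partial>R)" by simp
    qed
    also have "\<dots> = (\<integral>\<^sup>+ y. ennreal (h y) * (\<integral>\<^sup>+ \<theta>. G (\<theta>, T y) * indicator B \<theta> \<partial>R) * indicator A y \<partial>M)"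
    proof (rule nn_integral_cong)
      fix y assume "y \<in> space M"
      then have [measurable]: "T y \<in> space N" using measurable_space[OF T] by simp
      show "(\<integral>\<^sup>+ \<theta>. ennreal (h y) * G (\<theta>, T y) * indicator B \<theta> * indicator A y \<partial>R)
        = ennreal (h y) * (\<integral>\<^sup>+ \<theta>. G (\<theta>, T y) * indicator B \<theta> \<partial>R) * indicator A y"
        by (simp add: nn_integral_multc, simp add: mult.assoc nn_integral_cmult)
    qed
    finally show ?thesis .
  qed
  have Z_space: "(\<integral>\<^sup>+ \<theta>. G (\<theta>, t) * indicator (space R) \<theta> \<partial>R) = Z t" for t
    unfolding Z_def by (intro nn_integral_cong) auto
  have J_snd: "distr ?J M snd = density M (\<lambda>y. ennreal (h y) * Z (T y))"
  proof (rule measure_eqI)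
    fix A assume "A \<in> sets (distr ?J M snd)"
    then have A[measurable]: "A \<in> sets M" by simp
    have "emeasure (distr ?J M snd) A = emeasure ?J (space R \<times> A)"
      using sets.sets_into_space[OF A]
      by (subst emeasure_distr) (auto intro!: arg_cong2[where f = emeasure] simp: space_pair_measure)
    then show "emeasure (distr ?J M snd) A = emeasure (density M (\<lambda>y. ennreal (h y) * Z (T y))) A"
      unfolding J_rect[OF sets.top A] Z_space by (simp add: emeasure_density)
  qed simp
  have J_space: "emeasure ?J (space ?J) = 1"
  proof -
    have "emeasure ?J (space ?J) = (\<integral>\<^sup>+ z. p z \<partial>(R \<Otimes>\<^sub>M M))"
      by (subst emeasure_density) (auto intro!: nn_integral_cong)
    also have "\<dots> = (\<integral>\<^sup>+ \<theta>. (\<integral>\<^sup>+ y. p (\<theta>, y) \<partial>M) \<partial>R)" by (rule M.nn_integral_fst[symmetric]) measurable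
    also have "\<dots> = (\<integral>\<^sup>+ \<theta>. 1 \<partial>R)" by (intro nn_integral_cong p1)
    finally show ?thesis by (simp add: R.emeasure_space_1)
  qed
  then interpret J: prob_space ?J by (rule prob_spaceI)
  \<comment> \<open>\<open>Z\<close> may be infinite at some values of the statistic, but the
    marginal density has total mass at most 1; hence \<open>Z (T y)\<close> is finite for almost all
    \<open>y\<close> with \<open>h y > 0\<close>.\<close>
  have hZ_fin: "AE y in M. ennreal (h y) * Z (T y) \<noteq> \<infinity>"
  proof (rule nn_integral_PInf_AE)
    have "(\<integral>\<^sup>+ y. ennreal (h y) * Z (T y) \<partial>M) = emeasure (distr ?J M snd) (space M)"
      unfolding J_snd by (subst emeasure_density) (auto intro!: nn_integral_cong)
    also have "\<dots> \<le> 1" using J.emeasure_le_1 by (subst emeasure_distr) auto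
    finally show "(\<integral>\<^sup>+ y. ennreal (h y) * Z (T y) \<partial>M) \<noteq> \<infinity>" by (auto simp: top_unique)
  qed measurable
  have "posterior_version ?J R M (\<lambda>y. K (T y))"
    unfolding posterior_version_def
  proof (intro conjI ballI)
    fix B A assume B[measurable]: "B \<in> sets R" and A[measurable]: "A \<in> sets M"
    have m[measurable]: "(\<lambda>t. emeasure (K t) B) \<in> borel_measurable N"
      using measurable_compose[OF measurable_prob_algebraD[OF K] measurable_emeasure_subprob_algebra[OF B]] .
    have "emeasure ?J (B \<times> A) = (\<integral>\<^sup>+ y. ennreal (h y) * Z (T y) * (emeasure (K (T y)) B * indicator A y) \<partial>M)"
      unfolding J_rect[OF B A]
    proof (rule nn_integral_cong_AE)
      show "AE y in M. ennreal (h y) * (\<integral>\<^sup>+ \<theta>. G (\<theta>, T y) * indicator B \<theta> \<partial>R) * indicator A y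
        = ennreal (h y) * Z (T y) * (emeasure (K (T y)) B * indicator A y)"
        using hZ_fin AE_space
      proof eventually_elim
        case (elim y)
        show ?case
        proof (cases "ennreal (h y) = 0")
          case False
          then have "Z (T y) \<noteq> \<infinity>" using elim(1) by (auto simp: ennreal_mult_eq_top_iff)
          then show ?thesis using ZK[of "T y" B] elim(2) measurable_space[OF T] B
            by (simp flip: ZK add: ac_simps)
        qed simp
      qed
    qed
    then show "emeasure ?J (B \<times> A) = (\<integral>\<^sup>+ y. emeasure (K (T y)) B * indicator A y \<partial>distr ?J M snd)"
      unfolding J_snd by (simp add: nn_integral_density)
  qed measurable
  then show ?thesis
    by (intro same_posterior_if_kernel_of_statistic[of _ _ _ _ _ K] T K) (auto intro: J.finite_measure_axioms)
qed

section \<open>Finite products of sigma-finite measures\<close>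

text \<open>The locale \<open>product_sigma_finite\<close> asks for sigma-finiteness at every index,
  while the base measures are controlled on \<open>I\<close> only. A point mass outside
  \<open>I\<close> repairs this without changing the product over \<open>I\<close>.\<close>

lemma PiM_as_product_sigma_finite:
  assumes "\<forall>i\<in>I. sigma_finite_measure (M i)"
  obtains M' where "product_sigma_finite M'" "PiM I M' = PiM I M" "\<And>i. i \<in> I \<Longrightarrow> M' i = M i"
proof -
  let ?M' = "\<lambda>i. if i \<in> I then M i else return (count_space UNIV) undefined"
  have "sigma_finite_measure (?M' i)" for i
    using assms prob_space_return[of undefined "count_space UNIV"]
    by (auto intro!: finite_measure.axioms(1) prob_space.axioms(1))
  then have "product_sigma_finite ?M'" by (simp add: product_sigma_finite_def)
  from that[OF this] show thesis by (simp cong: PiM_cong)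
qed

lemma sigma_finite_measure_PiM:
  assumes "finite I" "\<forall>i\<in>I. sigma_finite_measure (M i)"
  shows "sigma_finite_measure (PiM I M)"
proof -
  obtain M' where "product_sigma_finite M'" "PiM I M' = PiM I M"
    using PiM_as_product_sigma_finite[OF assms(2)] by blast
  then show ?thesis using product_sigma_finite.sigma_finite[of M' I] assms(1) by simp
qed

lemma nn_integral_PiM_prod:
  assumes "finite I" "\<forall>i\<in>I. sigma_finite_measure (M i)"
    and f: "\<And>i. i \<in> I \<Longrightarrow> f i \<in> borel_measurable (M i)"
  shows "(\<integral>\<^sup>+ x. (\<Prod>i\<in>I. f i (x i)) \<partial>PiM I M) = (\<Prod>i\<in>I. \<integral>\<^sup>+ x. f i x \<partial>M i)"
proof -
  obtain M' where "product_sigma_finite M'" and eq: "PiM I M' = PiM I M"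
    and M': "\<And>i. i \<in> I \<Longrightarrow> M' i = M i"
    using PiM_as_product_sigma_finite[OF assms(2)] by blast
  then have "(\<integral>\<^sup>+ x. (\<Prod>i\<in>I. f i (x i)) \<partial>PiM I M') = (\<Prod>i\<in>I. \<integral>\<^sup>+ x. f i x \<partial>M' i)"
    using f assms(1) by (intro product_sigma_finite.product_nn_integral_prod) auto
  then show ?thesis using M' by (simp add: eq)
qed

text \<open>The exceptional set lies in a box with one null side. Its measure is a product with a
  factor 0, which is 0 even if other sides have infinite measure.\<close>

lemma AE_PiM_component_sigma_finite:
  assumes fin: "finite I" and sf: "\<forall>i\<in>I. sigma_finite_measure (M i)" and i: "i \<in> I"
    and P: "AE x in M i. P x"
  shows "AE x in PiM I M. P (x i)"
proof -
  obtain M' where M': "product_sigma_finite M'" and eq: "PiM I M' = PiM I M"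
    and M'_eq: "\<And>i. i \<in> I \<Longrightarrow> M' i = M i"
    using PiM_as_product_sigma_finite[OF sf] by blast
  obtain E where E: "{x \<in> space (M i). \<not> P x} \<subseteq> E" "E \<in> null_sets (M i)"
    using P by (auto elim!: AE_E simp: null_sets_def)
  let ?E = "PiE I (\<lambda>j. if j = i then E else space (M j))"
  have Es: "(if j = i then E else space (M j)) \<in> sets (M' j)" if "j \<in> I" for j
    using E(2) that M'_eq by auto
  have "emeasure (PiM I M') ?E = (\<Prod>j\<in>I. emeasure (M' j) (if j = i then E else space (M j)))"
    using fin Es by (intro product_sigma_finite.emeasure_PiM[OF M']) auto
  also have "\<dots> = 0" using fin i E(2) M'_eq[OF i] by (intro prod_zero bexI[of _ i]) auto
  finally have "emeasure (PiM I M) ?E = 0" by (simp only: eq)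
  moreover have "?E \<in> sets (PiM I M)"
    unfolding eq[symmetric] using fin Es by (intro sets_PiM_I_finite) auto
  ultimately have "?E \<in> null_sets (PiM I M)" by (rule null_setsI)
  moreover have "{x \<in> space (PiM I M). \<not> P (x i)} \<subseteq> ?E"
  proof
    fix x assume "x \<in> {x \<in> space (PiM I M). \<not> P (x i)}"
    then have x: "x \<in> space (PiM I M)" "\<not> P (x i)" by auto
    then have "x i \<in> E" using E(1) i by (auto simp: space_PiM PiE_def Pi_def)
    then show "x \<in> ?E" using x(1) by (auto simp: space_PiM PiE_def Pi_def)
  qed
  ultimately show ?thesis by (rule AE_I')
qed

lemma measurable_PiM_component_compose:
  assumes "i \<in> I" "f \<in> M i \<rightarrow>\<^sub>M L"
  shows "(\<lambda>x. f (x i)) \<in> PiM I M \<rightarrow>\<^sub>M L"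
  using measurable_compose[of "\<lambda>x. x i" "PiM I M" "M i" f L] assms measurable_component_singleton[of i I M]
  by simp

lemma measurable_joint_statistic:
  assumes "\<And>i. i \<in> I \<Longrightarrow> T i \<in> M i \<rightarrow>\<^sub>M N i"
  shows "joint_statistic I T \<in> PiM I M \<rightarrow>\<^sub>M PiM I N"
  unfolding joint_statistic_def [abs_def]
proof (rule measurable_restrict)
  fix i assume i: "i \<in> I"
  show "(\<lambda>y. T i (y i)) \<in> PiM I M \<rightarrow>\<^sub>M N i"
    using i assms[OF i] by (rule measurable_PiM_component_compose)
qed

section \<open>From working models to the marginal model of the data\<close>

lemma sufficientE:
  fixes M :: "'y measure" and N :: "'t measure"
  assumes "sufficient M N \<Psi> f T"
  obtains h :: "'y \<Rightarrow> real" where "h \<in> borel_measurable M" "\<And>y. 0 \<le> h y"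
    "\<And>\<psi>. \<psi> \<in> \<Psi> \<Longrightarrow> \<exists>k :: 't \<Rightarrow> real. k \<in> borel_measurable N \<and> (\<forall>t. 0 \<le> k t) \<and>
      (AE y in M. f \<psi> y = ennreal (h y * k (T y)))"
  using assms unfolding sufficient_def by blast

text \<open>Each factorization holds off a null set of its own coordinate; lifted to the product
  space these sets remain null, and there are finitely many of them.\<close>

lemma factors_through_prod:
  assumes fin: "finite I" and sf: "\<forall>i\<in>I. sigma_finite_measure (M i)"
    and f: "\<And>i. i \<in> I \<Longrightarrow> \<exists>k :: 't \<Rightarrow> real. k \<in> borel_measurable (N i) \<and> (\<forall>t. 0 \<le> k t) \<and>
      (AE y in M i. f i y = ennreal (h i y * k (T i y)))"
    and h: "\<And>i y. i \<in> I \<Longrightarrow> 0 \<le> h i y"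
  shows "factors_through (PiM I M) (PiM I N) (joint_statistic I T) (\<lambda>y. \<Prod>i\<in>I. h i (y i)) (\<lambda>y. \<Prod>i\<in>I. f i (y i))"
proof -
  have "\<forall>i\<in>I. \<exists>k :: 't \<Rightarrow> real. k \<in> borel_measurable (N i) \<and> (\<forall>t. 0 \<le> k t) \<and>
      (AE y in M i. f i y = ennreal (h i y * k (T i y)))"
    using f by blast
  from bchoice[OF this] obtain k :: "'a \<Rightarrow> 't \<Rightarrow> real" where
    km: "\<And>i. i \<in> I \<Longrightarrow> k i \<in> borel_measurable (N i)" and k0: "\<And>i t. i \<in> I \<Longrightarrow> 0 \<le> k i t"
    and k: "\<And>i. i \<in> I \<Longrightarrow> AE y in M i. f i y = ennreal (h i y * k i (T i y))"
    by blast
  have "AE y in PiM I M. \<forall>i\<in>I. f i (y i) = ennreal (h i (y i) * k i (T i (y i)))"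
    by (intro AE_finite_allI fin AE_PiM_component_sigma_finite[OF fin sf _ k])
  then have "AE y in PiM I M. (\<Prod>i\<in>I. f i (y i))
      = ennreal (\<Prod>i\<in>I. h i (y i)) * (\<Prod>i\<in>I. ennreal (k i (joint_statistic I T y i)))"
  proof eventually_elim
    case (elim y)
    have "(\<Prod>i\<in>I. f i (y i)) = (\<Prod>i\<in>I. ennreal (h i (y i)) * ennreal (k i (joint_statistic I T y i)))"
      using elim h by (intro prod.cong) (auto simp: ennreal_mult' joint_statistic_def)
    then show ?case using h by (simp add: prod.distrib prod_ennreal)
  qed
  moreover have "(\<lambda>t. \<Prod>i\<in>I. ennreal (k i (t i))) \<in> borel_measurable (PiM I N)"
  proof (rule borel_measurable_prod_ennreal)
    fix i assume i: "i \<in> I"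
    show "(\<lambda>t. ennreal (k i (t i))) \<in> borel_measurable (PiM I N)"
    proof (rule measurable_PiM_component_compose[OF i])
      show "(\<lambda>s. ennreal (k i s)) \<in> borel_measurable (N i)" using km[OF i] by measurable
    qed
  qed
  ultimately show ?thesis unfolding factors_through_def by (rule bexI)
qed

text \<open>For fixed \<open>y\<close>, Tonelli moves the integral over \<open>x\<close> inside the
  one over \<eta>; given \<eta>, the integrand is a product of functions of single coordinates and
  the integral splits. The observation model factorizes off a null set of \<open>y\<close> that may
  depend on \<open>x\<close>, hence the initial passage through sections.\<close>

lemma marginal_mixture:
  fixes pY :: "('i \<Rightarrow> 'y) \<times> ('i \<Rightarrow> 'x) \<Rightarrow> ennreal"
  assumes fin: "finite I" and MX: "\<forall>i\<in>I. sigma_finite_measure (MX i)"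
    and MY: "\<forall>i\<in>I. sigma_finite_measure (MY i)"
    and P: "prob_space P" and sP[measurable_cong]: "sets P = sets H"
    and q: "\<And>i. i \<in> I \<Longrightarrow> q i \<in> borel_measurable (MY i \<Otimes>\<^sub>M MX i)"
    and w: "\<And>i. i \<in> I \<Longrightarrow> w i \<in> borel_measurable (H \<Otimes>\<^sub>M MX i)"
    and pY[measurable]: "pY \<in> borel_measurable (PiM I MY \<Otimes>\<^sub>M PiM I MX)"
    and pYq: "\<And>x. x \<in> space (PiM I MX) \<Longrightarrow> AE y in PiM I MY. pY (y, x) = (\<Prod>i\<in>I. q i (y i, x i))"
    and pX[measurable]: "pX \<in> borel_measurable (PiM I MX)"
    and pXw: "AE x in PiM I MX. pX x = (\<integral>\<^sup>+ \<eta>. (\<Prod>i\<in>I. w i (\<eta>, x i)) \<partial>P)"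
  shows "AE y in PiM I MY. (\<integral>\<^sup>+ x. pY (y, x) * pX x \<partial>PiM I MX) =
    (\<integral>\<^sup>+ \<eta>. (\<Prod>i\<in>I. \<integral>\<^sup>+ x. q i (y i, x) * w i (\<eta>, x) \<partial>MX i) \<partial>P)"
proof -
  interpret P: prob_space P by fact
  have sfX: "sigma_finite_measure (PiM I MX)" using fin MX by (rule sigma_finite_measure_PiM)
  have sfY: "sigma_finite_measure (PiM I MY)" using fin MY by (rule sigma_finite_measure_PiM)
  interpret X: sigma_finite_measure "PiM I MX" by (rule sfX)
  interpret XP: pair_sigma_finite "PiM I MX" P ..
  have "AE y in PiM I MY. (\<integral>\<^sup>+ x. (\<lambda>(x, y). pY (y, x) * pX x) (x, y) \<partial>PiM I MX) =
      (\<integral>\<^sup>+ x. (\<lambda>(x, y). (\<Prod>i\<in>I. q i (y i, x i)) * pX x) (x, y) \<partial>PiM I MX)"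
  proof (rule AE_nn_integral_eq_of_sections[OF sfX sfY])
    have "(\<lambda>(x, y). q i (y i, x i)) \<in> borel_measurable (PiM I MX \<Otimes>\<^sub>M PiM I MY)" if "i \<in> I" for i
      using that q[OF that] by measurable
    then show "(\<lambda>(x, y). (\<Prod>i\<in>I. q i (y i, x i)) * pX x) \<in> borel_measurable (PiM I MX \<Otimes>\<^sub>M PiM I MY)"
      by (auto simp: split_beta' intro!: borel_measurable_times_ennreal borel_measurable_prod_ennreal)
    fix x assume "x \<in> space (PiM I MX)"
    from pYq[OF this] show "AE y in PiM I MY. (\<lambda>(x, y). pY (y, x) * pX x) (x, y) =
        (\<lambda>(x, y). (\<Prod>i\<in>I. q i (y i, x i)) * pX x) (x, y)"
      by eventually_elim simp
  qed measurable
  then show ?thesis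
    using AE_space
  proof eventually_elim
    case (elim y)
    have yi: "y i \<in> space (MY i)" if "i \<in> I" for i using elim(2) that by (auto simp: space_PiM)
    have qy: "(\<lambda>x. q i (y i, x)) \<in> borel_measurable (MX i)" if "i \<in> I" for i
      using yi[OF that] q[OF that] by measurable
    have qyx: "(\<lambda>x. q i (y i, x i)) \<in> borel_measurable (PiM I MX)" if "i \<in> I" for i
      using that qy[OF that] by (rule measurable_PiM_component_compose)
    have w_eta: "(\<lambda>x. w i (\<eta>, x)) \<in> borel_measurable (MX i)" if "i \<in> I" "\<eta> \<in> space P" for i \<eta>
    proof -
      have [measurable]: "\<eta> \<in> space H" using that(2) sets_eq_imp_space_eq[OF sP] by simp
      show ?thesis using w[OF that(1)] by measurable
    qed
    have wx: "(\<lambda>\<eta>. w i (\<eta>, x i)) \<in> borel_measurable P" if "i \<in> I" "x \<in> space (PiM I MX)" for i x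
    proof -
      have [measurable]: "x i \<in> space (MX i)" using that by (auto simp: space_PiM)
      show ?thesis using w[OF that(1)] by measurable
    qed
    have wj: "(\<lambda>z. w i (snd z, fst z i)) \<in> borel_measurable (PiM I MX \<Otimes>\<^sub>M P)" if "i \<in> I" for i
      using that w[OF that] by measurable
    have qj: "(\<lambda>z. q i (y i, fst z i)) \<in> borel_measurable (PiM I MX \<Otimes>\<^sub>M P)" if "i \<in> I" for i
      by (rule measurable_compose[OF measurable_fst qyx[OF that]])
    have "(\<integral>\<^sup>+ x. pY (y, x) * pX x \<partial>PiM I MX) = (\<integral>\<^sup>+ x. (\<Prod>i\<in>I. q i (y i, x i)) * pX x \<partial>PiM I MX)"
      using elim(1) by simp
    also have "\<dots> = (\<integral>\<^sup>+ x. (\<integral>\<^sup>+ \<eta>. (\<Prod>i\<in>I. q i (y i, x i) * w i (\<eta>, x i)) \<partial>P) \<partial>PiM I MX)"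
    proof (rule nn_integral_cong_AE)
      show "AE x in PiM I MX. (\<Prod>i\<in>I. q i (y i, x i)) * pX x =
          (\<integral>\<^sup>+ \<eta>. (\<Prod>i\<in>I. q i (y i, x i) * w i (\<eta>, x i)) \<partial>P)"
        using pXw AE_space
      proof eventually_elim
        case (elim x)
        then show ?case
          by (simp add: prod.distrib nn_integral_cmult borel_measurable_prod_ennreal wx)
      qed
    qed
    also have "\<dots> = (\<integral>\<^sup>+ \<eta>. (\<integral>\<^sup>+ x. (\<Prod>i\<in>I. q i (y i, x i) * w i (\<eta>, x i)) \<partial>PiM I MX) \<partial>P)"
      by (rule XP.Fubini'[symmetric])
        (auto simp: split_beta' intro!: borel_measurable_prod_ennreal borel_measurable_times_ennreal wj qj)
    also have "\<dots> = (\<integral>\<^sup>+ \<eta>. (\<Prod>i\<in>I. \<integral>\<^sup>+ x. q i (y i, x) * w i (\<eta>, x) \<partial>MX i) \<partial>P)"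
      by (intro nn_integral_cong nn_integral_PiM_prod[OF fin MX, where f = "\<lambda>i x. q i (y i, x) * w i (_, x)"])
        (auto intro!: borel_measurable_times_ennreal qy w_eta)
    finally show ?case .
  qed
qed

lemma prob_density_marginal_model:
  assumes "sigma_finite_measure MX" "sigma_finite_measure MY"
    and [measurable]: "(\<lambda>(y, x). pY y x \<xi>) \<in> borel_measurable (MY \<Otimes>\<^sub>M MX)"
    and pY: "\<And>x. x \<in> space MX \<Longrightarrow> prob_density MY (\<lambda>y. pY y x \<xi>)"
    and pX: "prob_density MX (\<lambda>x. pX x \<theta>)"
  shows "prob_density MY (\<lambda>y. marginal_model MX pY pX y \<theta> \<xi>)"
proof -
  interpret X: sigma_finite_measure MX by fact
  interpret Y: sigma_finite_measure MY by fact
  interpret YX: pair_sigma_finite MY MX ..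
  have [measurable]: "(\<lambda>x. pX x \<theta>) \<in> borel_measurable MX" using pX by (simp add: prob_density_def)
  have "(\<integral>\<^sup>+ y. marginal_model MX pY pX y \<theta> \<xi> \<partial>MY) = (\<integral>\<^sup>+ x. (\<integral>\<^sup>+ y. pY y x \<xi> * pX x \<theta> \<partial>MY) \<partial>MX)"
    unfolding marginal_model_def by (rule YX.Fubini'[symmetric]) measurable
  also have "\<dots> = (\<integral>\<^sup>+ x. pX x \<theta> \<partial>MX)"
  proof (rule nn_integral_cong)
    fix x assume "x \<in> space MX"
    from pY[OF this] show "(\<integral>\<^sup>+ y. pY y x \<xi> * pX x \<theta> \<partial>MY) = pX x \<theta>"
      by (simp add: prob_density_def nn_integral_multc)
  qed
  also have "\<dots> = 1" using pX by (simp add: prob_density_def)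
  finally show ?thesis unfolding prob_density_def by (auto simp: marginal_model_def)
qed

lemma prob_space_density_of_prob_density:
  "prob_density M f \<Longrightarrow> prob_space (density M f)"
  by (auto simp: prob_density_def emeasure_density intro!: prob_spaceI cong: nn_integral_cong)

lemma density_cong_space:
  assumes [measurable]: "g \<in> borel_measurable M" and "\<And>x. x \<in> space M \<Longrightarrow> f x = g x"
  shows "density M f = density M g"
  using assms measurable_cong[of M f g borel] by (intro density_cong) auto

text \<open>Under a factorized prior the tuple of parts of \<xi> has a product law, so the integral
  over \<xi> becomes one over that product space and splits.\<close>

lemma nn_integral_factorized_prior:
  assumes fin: "finite I"
    and prior: "prior_factorizes I C M\<xi> \<pi> M\<xi>i \<pi>i"
    and \<pi>i: "\<And>i. i \<in> I \<Longrightarrow> prob_density (M\<xi>i i) (\<pi>i i)"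
    and u: "\<And>i. i \<in> I \<Longrightarrow> u i \<in> borel_measurable (M\<xi>i i)"
  shows "(\<integral>\<^sup>+ \<xi>. (\<Prod>i\<in>I. u i (restrict \<xi> (C i))) \<partial>density M\<xi> \<pi>)
    = (\<Prod>i\<in>I. \<integral>\<^sup>+ z. u i z \<partial>density (M\<xi>i i) (\<pi>i i))"
proof -
  have res: "(\<lambda>\<xi>. restrict \<xi> (C i)) \<in> M\<xi> \<rightarrow>\<^sub>M M\<xi>i i" if "i \<in> I" for i
    using prior that by (simp add: prior_factorizes_def)
  have prob: "prob_space (density (M\<xi>i i) (\<pi>i i))" if "i \<in> I" for i
    using \<pi>i[OF that] by (rule prob_space_density_of_prob_density)
  have um: "(\<lambda>z. \<Prod>i\<in>I. u i (z i)) \<in> borel_measurable (PiM I M\<xi>i)"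
    by (intro borel_measurable_prod_ennreal measurable_PiM_component_compose u)
  have "(\<lambda>\<xi>. \<lambda>i\<in>I. restrict \<xi> (C i)) \<in> M\<xi> \<rightarrow>\<^sub>M PiM I M\<xi>i"
    by (intro measurable_restrict res)
  then have "(\<integral>\<^sup>+ \<xi>. (\<Prod>i\<in>I. u i (restrict \<xi> (C i))) \<partial>density M\<xi> \<pi>)
    = (\<integral>\<^sup>+ z. (\<Prod>i\<in>I. u i (z i)) \<partial>distr (density M\<xi> \<pi>) (PiM I M\<xi>i) (\<lambda>\<xi>. \<lambda>i\<in>I. restrict \<xi> (C i)))"
    by (subst nn_integral_distr) (auto simp: um)
  also have "\<dots> = (\<integral>\<^sup>+ z. (\<Prod>i\<in>I. u i (z i)) \<partial>PiM I (\<lambda>i. density (M\<xi>i i) (\<pi>i i)))"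
    using prior by (simp add: prior_factorizes_def)
  also have "\<dots> = (\<Prod>i\<in>I. \<integral>\<^sup>+ z. u i z \<partial>density (M\<xi>i i) (\<pi>i i))"
    using fin prob u by (intro nn_integral_PiM_prod) (auto intro: prob_space_imp_sigma_finite)
  finally show ?thesis .
qed

theorem theorem1:
  fixes r :: nat
    and MX :: "nat \<Rightarrow> 'x measure" and MY :: "nat \<Rightarrow> 'y measure"
    and H :: "'eta measure"
    and \<Theta> :: "'theta set" and \<Xi> :: "('k \<Rightarrow> 'c) set"
    and J :: "'k set" and C :: "nat \<Rightarrow> 'k set"
    and pX :: "(nat \<Rightarrow> 'x) \<Rightarrow> 'theta \<Rightarrow> ennreal"
    and pY :: "(nat \<Rightarrow> 'y) \<Rightarrow> (nat \<Rightarrow> 'x) \<Rightarrow> ('k \<Rightarrow> 'c) \<Rightarrow> ennreal"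
    and pYi :: "nat \<Rightarrow> 'y \<Rightarrow> 'x \<Rightarrow> ('k \<Rightarrow> 'c) \<Rightarrow> ennreal"
    and wX :: "nat \<Rightarrow> 'x \<Rightarrow> 'gam \<Rightarrow> ennreal"
    and g :: "nat \<Rightarrow> 'eta \<Rightarrow> 'gam"
    and N :: "nat \<Rightarrow> 't measure" and T :: "nat \<Rightarrow> 'y \<Rightarrow> 't"
    and R :: "'theta measure"
    and M\<xi> :: "('k \<Rightarrow> 'c) measure" and \<pi> :: "('k \<Rightarrow> 'c) \<Rightarrow> ennreal"
    and M\<xi>i :: "nat \<Rightarrow> ('k \<Rightarrow> 'c) measure" and \<pi>i :: "nat \<Rightarrow> ('k \<Rightarrow> 'c) \<Rightarrow> ennreal"
    and NB :: "nat \<Rightarrow> 'tb measure" and TB :: "nat \<Rightarrow> 'y \<Rightarrow> 'tb"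
  defines "I \<equiv> {1..r}"
  assumes base_X: "\<forall>i\<in>I. sigma_finite_measure (MX i)"
    and base_Y: "\<forall>i\<in>I. sigma_finite_measure (MY i)"
    and nuisance: "\<Xi> \<subseteq> extensional J" "parts_of I J C"
    and scientific_model: "\<forall>\<theta>\<in>\<Theta>. prob_density (PiM I MX) (\<lambda>x. pX x \<theta>)"
    and observation_model:
      "\<forall>\<xi>\<in>\<Xi>. (\<lambda>(y, x). pY y x \<xi>) \<in> borel_measurable (PiM I MY \<Otimes>\<^sub>M PiM I MX)"
      "\<forall>\<xi>\<in>\<Xi>. \<forall>x\<in>space (PiM I MX). prob_density (PiM I MY) (\<lambda>y. pY y x \<xi>)"
    and observation_models_i:
      "\<forall>i\<in>I. \<forall>\<xi>\<in>\<Xi>. (\<lambda>(y, x). pYi i y x (restrict \<xi> (C i))) \<in> borel_measurable (MY i \<Otimes>\<^sub>M MX i)"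
      "\<forall>i\<in>I. \<forall>\<xi>\<in>\<Xi>. \<forall>x\<in>space (MX i). prob_density (MY i) (\<lambda>y. pYi i y x (restrict \<xi> (C i)))"
    and working_models:
      "\<forall>i\<in>I. (\<lambda>(\<eta>, x). wX i x (g i \<eta>)) \<in> borel_measurable (H \<Otimes>\<^sub>M MX i)"
      "\<forall>i\<in>I. \<forall>\<eta>\<in>space H. prob_density (MX i) (\<lambda>x. wX i x (g i \<eta>))"
    and observation_factorizes:
      "\<forall>\<xi>\<in>\<Xi>. \<forall>x\<in>space (PiM I MX). AE y in PiM I MY.
        pY y x \<xi> = (\<Prod>i\<in>I. pYi i (y i) (x i) (restrict \<xi> (C i)))"
    and separable: "distributed_separable I MX H \<Theta> pX wX g"
    and T_sufficient:
      "\<forall>i\<in>I. sufficient (MY i) (N i) ((g i ` space H) \<times> ((\<lambda>\<xi>. restrict \<xi> (C i)) ` \<Xi>))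
        (\<lambda>(\<gamma>, \<xi>i) y. marginal_model (MX i) (pYi i) (wX i) y \<gamma> \<xi>i) (T i)"
  shows "same_likelihood (PiM I MY) (PiM I N) (\<Theta> \<times> \<Xi>)
      (\<lambda>(\<theta>, \<xi>) y. marginal_model (PiM I MX) pY pX y \<theta> \<xi>) (joint_statistic I T)
    \<and>
    (prob_space R \<and> space R = \<Theta> \<and>
     (\<lambda>(x, \<theta>). pX x \<theta>) \<in> borel_measurable (PiM I MX \<Otimes>\<^sub>M R) \<and>
     space M\<xi> = \<Xi> \<and> prob_density M\<xi> \<pi> \<and>
     (\<lambda>(y, x, \<xi>). pY y x \<xi>) \<in> borel_measurable (PiM I MY \<Otimes>\<^sub>M PiM I MX \<Otimes>\<^sub>M M\<xi>) \<and>
     (\<forall>i\<in>I. space (M\<xi>i i) = (\<lambda>\<xi>. restrict \<xi> (C i)) ` \<Xi> \<and> prob_density (M\<xi>i i) (\<pi>i i) \<and>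
       (\<lambda>(y, x, \<xi>i). pYi i y x \<xi>i) \<in> borel_measurable (MY i \<Otimes>\<^sub>M MX i \<Otimes>\<^sub>M M\<xi>i i)) \<and>
     partition_into I J C \<and> prior_factorizes I C M\<xi> \<pi> M\<xi>i \<pi>i
     \<longrightarrow>
     same_posterior (joint_law R M\<xi> \<pi> (PiM I MY) (marginal_model (PiM I MX) pY pX))
       R (PiM I MY) (PiM I N) (joint_statistic I T) \<and>
     ((\<forall>i\<in>I. sufficient (MY i) (NB i) (g i ` space H)
        (\<lambda>\<gamma> y. \<integral>\<^sup>+ \<xi>i. (\<integral>\<^sup>+ x. pYi i y x \<xi>i * wX i x \<gamma> * \<pi>i i \<xi>i \<partial>MX i) \<partial>M\<xi>i i) (TB i))
      \<longrightarrow>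
      same_posterior (joint_law R M\<xi> \<pi> (PiM I MY) (marginal_model (PiM I MX) pY pX))
        R (PiM I MY) (PiM I NB) (joint_statistic I TB)))"
proof -
  let ?X = "PiM I MX" and ?Y = "PiM I MY"
  let ?f = "\<lambda>y \<theta> \<xi>. marginal_model ?X pY pX y \<theta> \<xi>"
  \<comment> \<open>The working densities are indexed by \<eta> instead of
    \<open>g i \<eta>\<close>, since both the mixing measure and the measurability of the working
    models refer to \<eta>.\<close>
  let ?m = "\<lambda>i y \<eta> \<zeta>. marginal_model (MX i) (pYi i) (wX i) y (g i \<eta>) \<zeta>"
  have fin: "finite I" by (simp add: I_def)
  have sfX: "sigma_finite_measure ?X" using fin base_X by (rule sigma_finite_measure_PiM)
  have sfY: "sigma_finite_measure ?Y" using fin base_Y by (rule sigma_finite_measure_PiM)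
  interpret X: sigma_finite_measure ?X by (rule sfX)
  interpret Y: sigma_finite_measure ?Y by (rule sfY)
  have pYm: "(\<lambda>z. pY (fst z) (snd z) \<xi>) \<in> borel_measurable (?Y \<Otimes>\<^sub>M ?X)" if "\<xi> \<in> \<Xi>" for \<xi>
    using observation_model(1) that by (simp add: split_beta')
  have pXm: "(\<lambda>x. pX x \<theta>) \<in> borel_measurable ?X" if "\<theta> \<in> \<Theta>" for \<theta>
    using scientific_model that by (simp add: prob_density_def)
  have qm: "(\<lambda>z. pYi i (fst z) (snd z) (restrict \<xi> (C i))) \<in> borel_measurable (MY i \<Otimes>\<^sub>M MX i)"
    if "i \<in> I" "\<xi> \<in> \<Xi>" for i \<xi>
    using observation_models_i(1) that by (simp add: split_beta')
  have wm: "(\<lambda>z. wX i (snd z) (g i (fst z))) \<in> borel_measurable (H \<Otimes>\<^sub>M MX i)" if "i \<in> I" for i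
    using working_models(1) that by (simp add: split_beta')
  have mm: "(\<lambda>z. ?m i (snd z) (fst z) (restrict \<xi> (C i))) \<in> borel_measurable (H \<Otimes>\<^sub>M MY i)"
    if i: "i \<in> I" and \<xi>: "\<xi> \<in> \<Xi>" for i \<xi>
  proof -
    interpret sigma_finite_measure "MX i" using base_X i by blast
    have "(\<lambda>z. pYi i (fst (snd (fst z), snd z)) (snd (snd (fst z), snd z)) (restrict \<xi> (C i)) *
        wX i (snd (fst (fst z), snd z)) (g i (fst (fst (fst z), snd z))))
      \<in> borel_measurable ((H \<Otimes>\<^sub>M MY i) \<Otimes>\<^sub>M MX i)"
      by (intro borel_measurable_times_ennreal measurable_compose[OF _ qm[OF i \<xi>]] measurable_compose[OF _ wm[OF i]])
         measurable
    then have "(\<lambda>(z, x). pYi i (snd z) x (restrict \<xi> (C i)) * wX i x (g i (fst z)))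
      \<in> borel_measurable ((H \<Otimes>\<^sub>M MY i) \<Otimes>\<^sub>M MX i)" by (simp add: split_beta')
    then show ?thesis unfolding marginal_model_def by measurable
  qed
  have mprod: "(\<lambda>z. \<Prod>i\<in>I. ?m i (snd z i) (fst z) (restrict \<xi> (C i))) \<in> borel_measurable (P \<Otimes>\<^sub>M ?Y)"
    if \<xi>: "\<xi> \<in> \<Xi>" and [measurable_cong]: "sets P = sets H" for \<xi> P
  proof (rule borel_measurable_prod_ennreal)
    fix i assume i: "i \<in> I"
    have "(\<lambda>z. (fst z, snd z i)) \<in> P \<Otimes>\<^sub>M ?Y \<rightarrow>\<^sub>M H \<Otimes>\<^sub>M MY i" using i by measurable
    from measurable_compose[OF this mm[OF i \<xi>]]
    show "(\<lambda>z. ?m i (snd z i) (fst z) (restrict \<xi> (C i))) \<in> borel_measurable (P \<Otimes>\<^sub>M ?Y)" by simp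
  qed
  \<comment> \<open>\<open>P\<close> depends on \<theta> alone and precedes the quantifier over
    \<xi>. For \<open>TB\<close> the integral over \<xi> is taken with this \<open>P\<close> held
    fixed.\<close>
  have mixture: "\<exists>P. prob_space P \<and> sets P = sets H \<and> (\<forall>\<xi>\<in>\<Xi>. AE y in ?Y.
      ?f y \<theta> \<xi> = (\<integral>\<^sup>+ \<eta>. (\<Prod>i\<in>I. ?m i (y i) \<eta> (restrict \<xi> (C i))) \<partial>P))" if \<theta>: "\<theta> \<in> \<Theta>" for \<theta>
  proof -
    obtain P where P: "prob_space P" "sets P = sets H"
      and sep: "AE x in ?X. pX x \<theta> = (\<integral>\<^sup>+ \<eta>. (\<Prod>i\<in>I. wX i (x i) (g i \<eta>)) \<partial>P)"
      using separable \<theta> unfolding distributed_separable_def by blast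
    have "AE y in ?Y. ?f y \<theta> \<xi> = (\<integral>\<^sup>+ \<eta>. (\<Prod>i\<in>I. ?m i (y i) \<eta> (restrict \<xi> (C i))) \<partial>P)" if \<xi>: "\<xi> \<in> \<Xi>" for \<xi>
      using marginal_mixture[OF fin base_X base_Y P, where
          q = "\<lambda>i z. pYi i (fst z) (snd z) (restrict \<xi> (C i))" and
          w = "\<lambda>i z. wX i (snd z) (g i (fst z))" and
          pY = "\<lambda>z. pY (fst z) (snd z) \<xi>" and pX = "\<lambda>x. pX x \<theta>"]
        qm \<xi> wm pYm pXm \<theta> observation_factorizes sep
      by (simp add: marginal_model_def)
    with P show ?thesis by blast
  qed

  \<comment> \<open>The order of quantifiers matters: \<open>h\<close> is fixed before \<eta> and
    \<xi>, so only the choice over \<open>i\<close> is made globally, and \<open>k\<close> remains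
    parameterwise.\<close>
  have "\<forall>i\<in>I. \<exists>h :: 'y \<Rightarrow> real. h \<in> borel_measurable (MY i) \<and> (\<forall>y. 0 \<le> h y) \<and>
      (\<forall>\<eta>\<in>space H. \<forall>\<xi>\<in>\<Xi>. \<exists>k :: 't \<Rightarrow> real. k \<in> borel_measurable (N i) \<and> (\<forall>t. 0 \<le> k t) \<and>
        (AE y in MY i. ?m i y \<eta> (restrict \<xi> (C i)) = ennreal (h y * k (T i y))))"
  proof
    fix i assume i: "i \<in> I"
    obtain h :: "'y \<Rightarrow> real" where h: "h \<in> borel_measurable (MY i)" "\<And>y. 0 \<le> h y"
      and k: "\<And>\<psi>. \<psi> \<in> (g i ` space H) \<times> ((\<lambda>\<xi>. restrict \<xi> (C i)) ` \<Xi>) \<Longrightarrow>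
        \<exists>k :: 't \<Rightarrow> real. k \<in> borel_measurable (N i) \<and> (\<forall>t. 0 \<le> k t) \<and>
          (AE y in MY i. (case \<psi> of (\<gamma>, \<xi>i) \<Rightarrow> \<lambda>y. marginal_model (MX i) (pYi i) (wX i) y \<gamma> \<xi>i) y
            = ennreal (h y * k (T i y)))"
      using sufficientE[OF T_sufficient[rule_format, OF i]] by blast
    have "\<exists>k :: 't \<Rightarrow> real. k \<in> borel_measurable (N i) \<and> (\<forall>t. 0 \<le> k t) \<and>
        (AE y in MY i. ?m i y \<eta> (restrict \<xi> (C i)) = ennreal (h y * k (T i y)))"
      if "\<eta> \<in> space H" "\<xi> \<in> \<Xi>" for \<eta> \<xi>
      using k[of "(g i \<eta>, restrict \<xi> (C i))"] that by simp
    with h show "\<exists>h :: 'y \<Rightarrow> real. h \<in> borel_measurable (MY i) \<and> (\<forall>y. 0 \<le> h y) \<and>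
      (\<forall>\<eta>\<in>space H. \<forall>\<xi>\<in>\<Xi>. \<exists>k :: 't \<Rightarrow> real. k \<in> borel_measurable (N i) \<and> (\<forall>t. 0 \<le> k t) \<and>
        (AE y in MY i. ?m i y \<eta> (restrict \<xi> (C i)) = ennreal (h y * k (T i y))))"
      by blast
  qed
  from bchoice[OF this] obtain h :: "nat \<Rightarrow> 'y \<Rightarrow> real" where
    h: "\<And>i. i \<in> I \<Longrightarrow> h i \<in> borel_measurable (MY i)" and h0: "\<And>i y. i \<in> I \<Longrightarrow> 0 \<le> h i y" and
    hk: "\<And>i \<eta> \<xi>. i \<in> I \<Longrightarrow> \<eta> \<in> space H \<Longrightarrow> \<xi> \<in> \<Xi> \<Longrightarrow>
      \<exists>k :: 't \<Rightarrow> real. k \<in> borel_measurable (N i) \<and> (\<forall>t. 0 \<le> k t) \<and>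
        (AE y in MY i. ?m i y \<eta> (restrict \<xi> (C i)) = ennreal (h i y * k (T i y)))"
    by blast
  have Tm: "joint_statistic I T \<in> ?Y \<rightarrow>\<^sub>M PiM I N"
    using T_sufficient by (intro measurable_joint_statistic) (simp add: sufficient_def)
  have hm: "(\<lambda>y. \<Prod>i\<in>I. h i (y i)) \<in> borel_measurable ?Y"
    by (intro borel_measurable_prod measurable_PiM_component_compose h)
  have fac: "factors_through ?Y (PiM I N) (joint_statistic I T) (\<lambda>y. \<Prod>i\<in>I. h i (y i)) (\<lambda>y. ?f y \<theta> \<xi>)"
    if \<theta>: "\<theta> \<in> \<Theta>" and \<xi>: "\<xi> \<in> \<Xi>" for \<theta> \<xi>
  proof -
    obtain P where P: "prob_space P" "sets P = sets H"
      and mix: "AE y in ?Y. ?f y \<theta> \<xi> = (\<integral>\<^sup>+ \<eta>. (\<Prod>i\<in>I. ?m i (y i) \<eta> (restrict \<xi> (C i))) \<partial>P)"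
      using mixture[OF \<theta>] \<xi> by blast
    have "factors_through ?Y (PiM I N) (joint_statistic I T) (\<lambda>y. \<Prod>i\<in>I. h i (y i))
      (\<lambda>y. \<integral>\<^sup>+ \<eta>. (\<lambda>z. \<Prod>i\<in>I. ?m i (snd z i) (fst z) (restrict \<xi> (C i))) (\<eta>, y) \<partial>P)"
    proof (rule factors_through_nn_integral[OF prob_space_imp_sigma_finite[OF P(1)] sfY Tm hm mprod[OF \<xi> P(2)]])
      fix \<eta> assume "\<eta> \<in> space P"
      then have \<eta>: "\<eta> \<in> space H" using sets_eq_imp_space_eq[OF P(2)] by simp
      show "factors_through ?Y (PiM I N) (joint_statistic I T) (\<lambda>y. \<Prod>i\<in>I. h i (y i))
        (\<lambda>y. (\<lambda>z. \<Prod>i\<in>I. ?m i (snd z i) (fst z) (restrict \<xi> (C i))) (\<eta>, y))"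
        unfolding fst_conv snd_conv
        by (rule factors_through_prod[OF fin base_Y hk[OF _ \<eta> \<xi>] h0])
    qed
    then show ?thesis by (intro factors_through_cong_AE[OF mix]) simp
  qed
  have pd: "prob_density ?Y (\<lambda>y. ?f y \<theta> \<xi>)" if \<theta>: "\<theta> \<in> \<Theta>" and \<xi>: "\<xi> \<in> \<Xi>" for \<theta> \<xi>
    using observation_model scientific_model \<theta> \<xi>
    by (intro prob_density_marginal_model sfX sfY) auto
  have likelihood: "same_likelihood ?Y (PiM I N) (\<Theta> \<times> \<Xi>) (\<lambda>(\<theta>, \<xi>) y. ?f y \<theta> \<xi>) (joint_statistic I T)"
    by (rule same_likelihood_of_factors_through[OF sfY Tm hm]) (auto simp: fac pd)

  {
    assume R: "prob_space R" and R\<Theta>: "space R = \<Theta>"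
      and pXj[measurable]: "(\<lambda>(x, \<theta>). pX x \<theta>) \<in> borel_measurable (?X \<Otimes>\<^sub>M R)"
      and M\<xi>\<Xi>: "space M\<xi> = \<Xi>" and \<pi>: "prob_density M\<xi> \<pi>"
      and pYj[measurable]: "(\<lambda>(y, x, \<xi>). pY y x \<xi>) \<in> borel_measurable (?Y \<Otimes>\<^sub>M ?X \<Otimes>\<^sub>M M\<xi>)"
      and M\<xi>i: "\<And>i. i \<in> I \<Longrightarrow> space (M\<xi>i i) = (\<lambda>\<xi>. restrict \<xi> (C i)) ` \<Xi>"
      and \<pi>i: "\<And>i. i \<in> I \<Longrightarrow> prob_density (M\<xi>i i) (\<pi>i i)"
      and pYij: "\<And>i. i \<in> I \<Longrightarrow>
        (\<lambda>(y, x, \<xi>i). pYi i y x \<xi>i) \<in> borel_measurable (MY i \<Otimes>\<^sub>M MX i \<Otimes>\<^sub>M M\<xi>i i)"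
      and prior: "prior_factorizes I C M\<xi> \<pi> M\<xi>i \<pi>i"
    interpret R: prob_space R by (rule R)
    have [measurable]: "\<pi> \<in> borel_measurable M\<xi>" using \<pi> by (simp add: prob_density_def)
    let ?\<Pi> = "density M\<xi> \<pi>"
    have "prob_space ?\<Pi>" using \<pi> by (rule prob_space_density_of_prob_density)
    then interpret \<Pi>: prob_space ?\<Pi> .
    have fj[measurable]: "(\<lambda>((\<theta>, y), \<xi>). ?f y \<theta> \<xi>) \<in> borel_measurable ((R \<Otimes>\<^sub>M ?Y) \<Otimes>\<^sub>M M\<xi>)"
    proof -
      have "(\<lambda>z. (\<lambda>(y, x, \<xi>). pY y x \<xi>) (snd (fst (fst z)), snd z, snd (fst z)) *
          (\<lambda>(x, \<theta>). pX x \<theta>) (snd z, fst (fst (fst z))))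
        \<in> borel_measurable (((R \<Otimes>\<^sub>M ?Y) \<Otimes>\<^sub>M M\<xi>) \<Otimes>\<^sub>M ?X)"
        by measurable
      then have "(\<lambda>(z, x). pY (snd (fst z)) x (snd z) * pX x (fst (fst z)))
        \<in> borel_measurable (((R \<Otimes>\<^sub>M ?Y) \<Otimes>\<^sub>M M\<xi>) \<Otimes>\<^sub>M ?X)"
        by (simp add: split_beta')
      from X.borel_measurable_nn_integral[OF this]
      show ?thesis by (simp add: marginal_model_def split_beta')
    qed
    \<comment> \<open>The density of the data given \<theta> once \<xi> is averaged over its prior;
      \<open>law\<close> identifies it with the density in \<open>joint_law\<close>.\<close>
    let ?p = "\<lambda>z. \<integral>\<^sup>+ \<xi>. ?f (snd z) (fst z) \<xi> \<partial>?\<Pi>"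
    have fp: "(\<lambda>z. ?f (snd (fst z)) (fst (fst z)) (snd z)) \<in> borel_measurable ((R \<Otimes>\<^sub>M ?Y) \<Otimes>\<^sub>M ?\<Pi>)"
      using fj by (simp add: split_beta')
    have pm: "?p \<in> borel_measurable (R \<Otimes>\<^sub>M ?Y)"
      using fp by (intro \<Pi>.borel_measurable_nn_integral) (simp add: split_beta')
    have law: "joint_law R M\<xi> \<pi> ?Y (marginal_model ?X pY pX) = density (R \<Otimes>\<^sub>M ?Y) ?p"
      unfolding joint_law_def
    proof (rule density_cong_space[OF pm])
      fix z assume z: "z \<in> space (R \<Otimes>\<^sub>M ?Y)"
      have "(\<lambda>\<xi>. ?f (snd z) (fst z) \<xi>) \<in> borel_measurable M\<xi>"
        using measurable_compose[OF measurable_Pair1'[OF z] fj] by (simp add: split_beta')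
      then show "(case z of (\<theta>, y) \<Rightarrow> \<integral>\<^sup>+ \<xi>. ?f y \<theta> \<xi> * \<pi> \<xi> \<partial>M\<xi>) = ?p z"
        by (simp add: nn_integral_density split_beta' mult.commute)
    qed
    have fs: "(\<lambda>z. ?f (snd z) \<theta> (fst z)) \<in> borel_measurable (?\<Pi> \<Otimes>\<^sub>M ?Y)" if "\<theta> \<in> \<Theta>" for \<theta>
    proof -
      have [measurable]: "\<theta> \<in> space R" using that R\<Theta> by simp
      have "(\<lambda>z. ((\<theta>, snd z), fst z)) \<in> ?\<Pi> \<Otimes>\<^sub>M ?Y \<rightarrow>\<^sub>M (R \<Otimes>\<^sub>M ?Y) \<Otimes>\<^sub>M ?\<Pi>"
        by measurable
      from measurable_compose[OF this fp] show ?thesis by simp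
    qed
    have p1: "(\<integral>\<^sup>+ y. ?p (\<theta>, y) \<partial>?Y) = 1" if \<theta>: "\<theta> \<in> space R" for \<theta>
    proof -
      interpret PY: pair_sigma_finite ?\<Pi> ?Y ..
      have "(\<integral>\<^sup>+ y. ?p (\<theta>, y) \<partial>?Y) = (\<integral>\<^sup>+ \<xi>. (\<integral>\<^sup>+ y. ?f y \<theta> \<xi> \<partial>?Y) \<partial>?\<Pi>)"
        using fs[of \<theta>] \<theta> R\<Theta> PY.Fubini'[of "\<lambda>\<xi> y. ?f y \<theta> \<xi>"] by (simp add: split_beta')
      also have "\<dots> = (\<integral>\<^sup>+ \<xi>. 1 \<partial>?\<Pi>)"
        using pd \<theta> R\<Theta> M\<xi>\<Xi> by (intro nn_integral_cong) (simp add: prob_density_def)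
      finally show ?thesis using \<Pi>.emeasure_space_1 by simp
    qed
    have posterior: "same_posterior (joint_law R M\<xi> \<pi> ?Y (marginal_model ?X pY pX)) R ?Y (PiM I N) (joint_statistic I T)"
      unfolding law
    proof (rule same_posterior_of_factors_through[OF R sfY Tm hm pm p1])
      fix \<theta> assume "\<theta> \<in> space R"
      then have \<theta>: "\<theta> \<in> \<Theta>" using R\<Theta> by simp
      \<comment> \<open>For \<open>T\<close> the prior needs no splitting here: \<open>fac\<close>
        holds for every \<xi> with the same \<open>h\<close>, so \<xi> is integrated like any
        section parameter.\<close>
      have "factors_through ?Y (PiM I N) (joint_statistic I T) (\<lambda>y. \<Prod>i\<in>I. h i (y i))
        (\<lambda>y. \<integral>\<^sup>+ \<xi>. (\<lambda>z. ?f (snd z) \<theta> (fst z)) (\<xi>, y) \<partial>?\<Pi>)"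
        using M\<xi>\<Xi> by (intro factors_through_nn_integral[OF \<Pi>.sigma_finite_measure_axioms sfY Tm hm fs[OF \<theta>]])
          (simp add: fac \<theta>)
      then show "factors_through ?Y (PiM I N) (joint_statistic I T) (\<lambda>y. \<Prod>i\<in>I. h i (y i)) (\<lambda>y. ?p (\<theta>, y))"
        by simp
    qed
    have "same_posterior (joint_law R M\<xi> \<pi> ?Y (marginal_model ?X pY pX)) R ?Y (PiM I NB) (joint_statistic I TB)"
      if TB_sufficient: "\<forall>i\<in>I. sufficient (MY i) (NB i) (g i ` space H)
        (\<lambda>\<gamma> y. \<integral>\<^sup>+ \<xi>i. (\<integral>\<^sup>+ x. pYi i y x \<xi>i * wX i x \<gamma> * \<pi>i i \<xi>i \<partial>MX i) \<partial>M\<xi>i i) (TB i)"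
    proof -
      let ?\<Pi>i = "\<lambda>i. density (M\<xi>i i) (\<pi>i i)"
      \<comment> \<open>Averages against the prior measure, for which the product formula is stated;
        \<open>mB_eq\<close> matches them with the double integrals in the hypothesis on
        \<open>TB\<close>.\<close>
      let ?mB = "\<lambda>i y \<eta>. \<integral>\<^sup>+ \<zeta>. ?m i y \<eta> \<zeta> \<partial>?\<Pi>i i"
      have \<Pi>i: "prob_space (?\<Pi>i i)" if "i \<in> I" for i
        using \<pi>i[OF that] by (rule prob_space_density_of_prob_density)
      have mj: "(\<lambda>z. ?m i (snd (fst z)) (fst (fst z)) (snd z)) \<in> borel_measurable ((H \<Otimes>\<^sub>M MY i) \<Otimes>\<^sub>M M\<xi>i i)"
        if i: "i \<in> I" for i
      proof -
        interpret sigma_finite_measure "MX i" using base_X i by blast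
        have [measurable]: "(\<lambda>(y, x, \<xi>i). pYi i y x \<xi>i) \<in> borel_measurable (MY i \<Otimes>\<^sub>M MX i \<Otimes>\<^sub>M M\<xi>i i)"
          "(\<lambda>(\<eta>, x). wX i x (g i \<eta>)) \<in> borel_measurable (H \<Otimes>\<^sub>M MX i)"
          using pYij[OF i] working_models(1) i by auto
        have "(\<lambda>z. (\<lambda>(y, x, \<xi>i). pYi i y x \<xi>i) (snd (fst (fst z)), snd z, snd (fst z)) *
            (\<lambda>(\<eta>, x). wX i x (g i \<eta>)) (fst (fst (fst z)), snd z))
          \<in> borel_measurable (((H \<Otimes>\<^sub>M MY i) \<Otimes>\<^sub>M M\<xi>i i) \<Otimes>\<^sub>M MX i)"
          by measurable
        then have "(\<lambda>(z, x). pYi i (snd (fst z)) x (snd z) * wX i x (g i (fst (fst z))))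
          \<in> borel_measurable (((H \<Otimes>\<^sub>M MY i) \<Otimes>\<^sub>M M\<xi>i i) \<Otimes>\<^sub>M MX i)"
          by (simp add: split_beta')
        from borel_measurable_nn_integral[OF this]
        show ?thesis by (simp add: marginal_model_def)
      qed
      have mBm: "(\<lambda>z. ?mB i (snd z) (fst z)) \<in> borel_measurable (H \<Otimes>\<^sub>M MY i)" if i: "i \<in> I" for i
      proof -
        interpret prob_space "?\<Pi>i i" using \<Pi>i[OF i] .
        show ?thesis using mj[OF i] by (intro borel_measurable_nn_integral) (simp add: split_beta')
      qed
      have mB_eq: "(\<integral>\<^sup>+ \<xi>i. (\<integral>\<^sup>+ x. pYi i y x \<xi>i * wX i x (g i \<eta>) * \<pi>i i \<xi>i \<partial>MX i) \<partial>M\<xi>i i) = ?mB i y \<eta>"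
        if i: "i \<in> I" and \<eta>: "\<eta> \<in> space H" and y: "y \<in> space (MY i)" for i \<eta> y
      proof -
        have [measurable]: "\<pi>i i \<in> borel_measurable (M\<xi>i i)" using \<pi>i[OF i] by (simp add: prob_density_def)
        have "(\<lambda>\<zeta>. ?m i y \<eta> \<zeta>) \<in> borel_measurable (M\<xi>i i)"
          using measurable_compose[OF measurable_Pair1'[of "(\<eta>, y)" "H \<Otimes>\<^sub>M MY i"] mj[OF i]] \<eta> y
          by (simp add: space_pair_measure)
        then have "?mB i y \<eta> = (\<integral>\<^sup>+ \<zeta>. \<pi>i i \<zeta> * ?m i y \<eta> \<zeta> \<partial>M\<xi>i i)"
          by (simp add: nn_integral_density)
        also have "\<dots> = (\<integral>\<^sup>+ \<xi>i. (\<integral>\<^sup>+ x. pYi i y x \<xi>i * wX i x (g i \<eta>) * \<pi>i i \<xi>i \<partial>MX i) \<partial>M\<xi>i i)"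
        proof (rule nn_integral_cong)
          fix \<zeta> assume "\<zeta> \<in> space (M\<xi>i i)"
          \<comment> \<open>Every point of the parameter space of researcher \<open>i\<close> is the
            restriction of some member of \<open>\<Xi>\<close>, which is where \<open>qm\<close>
            gives measurability.\<close>
          then obtain \<xi> where \<xi>: "\<xi> \<in> \<Xi>" "\<zeta> = restrict \<xi> (C i)" using M\<xi>i[OF i] by auto
          have [measurable]: "(\<lambda>x. pYi i y x \<zeta>) \<in> borel_measurable (MX i)"
            using measurable_compose[OF measurable_Pair1'[OF y] qm[OF i \<xi>(1)]] \<xi>(2) by simp
          have [measurable]: "(\<lambda>x. wX i x (g i \<eta>)) \<in> borel_measurable (MX i)"
            using measurable_compose[OF measurable_Pair1'[OF \<eta>] wm[OF i]] by simp
          show "\<pi>i i \<zeta> * ?m i y \<eta> \<zeta> = (\<integral>\<^sup>+ x. pYi i y x \<zeta> * wX i x (g i \<eta>) * \<pi>i i \<zeta> \<partial>MX i)"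
            by (subst nn_integral_multc) (auto simp: marginal_model_def mult.commute)
        qed
        finally show ?thesis by simp
      qed
      have "\<forall>i\<in>I. \<exists>h :: 'y \<Rightarrow> real. h \<in> borel_measurable (MY i) \<and> (\<forall>y. 0 \<le> h y) \<and>
          (\<forall>\<eta>\<in>space H. \<exists>k :: 'tb \<Rightarrow> real. k \<in> borel_measurable (NB i) \<and> (\<forall>t. 0 \<le> k t) \<and>
            (AE y in MY i. ?mB i y \<eta> = ennreal (h y * k (TB i y))))"
      proof
        fix i assume i: "i \<in> I"
        obtain h :: "'y \<Rightarrow> real" where h: "h \<in> borel_measurable (MY i)" "\<And>y. 0 \<le> h y"
          and k: "\<And>\<gamma>. \<gamma> \<in> g i ` space H \<Longrightarrow>
            \<exists>k :: 'tb \<Rightarrow> real. k \<in> borel_measurable (NB i) \<and> (\<forall>t. 0 \<le> k t) \<and>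
              (AE y in MY i. (\<integral>\<^sup>+ \<xi>i. (\<integral>\<^sup>+ x. pYi i y x \<xi>i * wX i x \<gamma> * \<pi>i i \<xi>i \<partial>MX i) \<partial>M\<xi>i i)
                = ennreal (h y * k (TB i y)))"
          using sufficientE[OF TB_sufficient[rule_format, OF i]] by blast
        have "\<exists>k :: 'tb \<Rightarrow> real. k \<in> borel_measurable (NB i) \<and> (\<forall>t. 0 \<le> k t) \<and>
            (AE y in MY i. ?mB i y \<eta> = ennreal (h y * k (TB i y)))" if \<eta>: "\<eta> \<in> space H" for \<eta>
        proof -
          obtain k :: "'tb \<Rightarrow> real" where k: "k \<in> borel_measurable (NB i)" "\<forall>t. 0 \<le> k t"
            "AE y in MY i. (\<integral>\<^sup>+ \<xi>i. (\<integral>\<^sup>+ x. pYi i y x \<xi>i * wX i x (g i \<eta>) * \<pi>i i \<xi>i \<partial>MX i) \<partial>M\<xi>i i)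
                = ennreal (h y * k (TB i y))"
            using k[OF imageI[OF \<eta>]] by blast
          from k(3) AE_space have "AE y in MY i. ?mB i y \<eta> = ennreal (h y * k (TB i y))"
            by eventually_elim (simp only: mB_eq[OF i \<eta>])
          with k(1,2) show ?thesis by blast
        qed
        with h show "\<exists>h :: 'y \<Rightarrow> real. h \<in> borel_measurable (MY i) \<and> (\<forall>y. 0 \<le> h y) \<and>
          (\<forall>\<eta>\<in>space H. \<exists>k :: 'tb \<Rightarrow> real. k \<in> borel_measurable (NB i) \<and> (\<forall>t. 0 \<le> k t) \<and>
            (AE y in MY i. ?mB i y \<eta> = ennreal (h y * k (TB i y))))"
          by blast
      qed
      from bchoice[OF this] obtain hB :: "nat \<Rightarrow> 'y \<Rightarrow> real" where
        hB: "\<And>i. i \<in> I \<Longrightarrow> hB i \<in> borel_measurable (MY i)" and hB0: "\<And>i y. i \<in> I \<Longrightarrow> 0 \<le> hB i y" and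
        kB: "\<And>i \<eta>. i \<in> I \<Longrightarrow> \<eta> \<in> space H \<Longrightarrow>
          \<exists>k :: 'tb \<Rightarrow> real. k \<in> borel_measurable (NB i) \<and> (\<forall>t. 0 \<le> k t) \<and>
            (AE y in MY i. ?mB i y \<eta> = ennreal (hB i y * k (TB i y)))"
        by blast
      have TBm: "joint_statistic I TB \<in> ?Y \<rightarrow>\<^sub>M PiM I NB"
        using TB_sufficient by (intro measurable_joint_statistic) (simp add: sufficient_def)
      have hBm: "(\<lambda>y. \<Prod>i\<in>I. hB i (y i)) \<in> borel_measurable ?Y"
        by (intro borel_measurable_prod measurable_PiM_component_compose hB)
      show ?thesis
        unfolding law
      proof (rule same_posterior_of_factors_through[OF R sfY TBm hBm pm p1])
        fix \<theta> assume "\<theta> \<in> space R"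
        then have \<theta>: "\<theta> \<in> \<Theta>" using R\<Theta> by simp
        obtain P where P: "prob_space P" and sP[measurable_cong]: "sets P = sets H"
          and mix: "\<And>\<xi>. \<xi> \<in> \<Xi> \<Longrightarrow>
            AE y in ?Y. ?f y \<theta> \<xi> = (\<integral>\<^sup>+ \<eta>. (\<Prod>i\<in>I. ?m i (y i) \<eta> (restrict \<xi> (C i))) \<partial>P)"
          using mixture[OF \<theta>] by blast
        interpret P: prob_space P by (rule P)
        interpret \<Pi>P: pair_sigma_finite ?\<Pi> P ..
        have res: "(\<lambda>\<xi>. restrict \<xi> (C i)) \<in> M\<xi> \<rightarrow>\<^sub>M M\<xi>i i" if "i \<in> I" for i
          using prior that by (simp add: prior_factorizes_def)
        have mr: "(\<lambda>z. \<Prod>i\<in>I. ?m i (snd (fst z) i) (snd z) (restrict (fst (fst z)) (C i)))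
            \<in> borel_measurable ((?\<Pi> \<Otimes>\<^sub>M ?Y) \<Otimes>\<^sub>M P)"
        proof (rule borel_measurable_prod_ennreal)
          fix i assume i: "i \<in> I"
          have "(\<lambda>z. ((snd z, snd (fst z) i), restrict (fst (fst z)) (C i)))
              \<in> (?\<Pi> \<Otimes>\<^sub>M ?Y) \<Otimes>\<^sub>M P \<rightarrow>\<^sub>M (H \<Otimes>\<^sub>M MY i) \<Otimes>\<^sub>M M\<xi>i i"
            using i res[OF i] by measurable
          from measurable_compose[OF this mj[OF i]]
          show "(\<lambda>z. ?m i (snd (fst z) i) (snd z) (restrict (fst (fst z)) (C i)))
            \<in> borel_measurable ((?\<Pi> \<Otimes>\<^sub>M ?Y) \<Otimes>\<^sub>M P)" by simp
        qed
        have "AE y in ?Y. (\<integral>\<^sup>+ \<xi>. (\<lambda>z. ?f (snd z) \<theta> (fst z)) (\<xi>, y) \<partial>?\<Pi>) =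
          (\<integral>\<^sup>+ \<xi>. (\<lambda>z. \<integral>\<^sup>+ \<eta>. (\<Prod>i\<in>I. ?m i (snd z i) \<eta> (restrict (fst z) (C i))) \<partial>P) (\<xi>, y) \<partial>?\<Pi>)"
        proof (rule AE_nn_integral_eq_of_sections[OF \<Pi>.sigma_finite_measure_axioms sfY fs[OF \<theta>]])
          show "(\<lambda>z. \<integral>\<^sup>+ \<eta>. (\<Prod>i\<in>I. ?m i (snd z i) \<eta> (restrict (fst z) (C i))) \<partial>P) \<in> borel_measurable (?\<Pi> \<Otimes>\<^sub>M ?Y)"
            using mr by (intro P.borel_measurable_nn_integral) (simp add: split_beta')
          fix \<xi> assume "\<xi> \<in> space ?\<Pi>"
          then have "\<xi> \<in> \<Xi>" using M\<xi>\<Xi> by simp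
          from mix[OF this] show "AE y in ?Y. (\<lambda>z. ?f (snd z) \<theta> (fst z)) (\<xi>, y) =
              (\<lambda>z. \<integral>\<^sup>+ \<eta>. (\<Prod>i\<in>I. ?m i (snd z i) \<eta> (restrict (fst z) (C i))) \<partial>P) (\<xi>, y)"
            unfolding fst_conv snd_conv .
        qed
        \<comment> \<open>Sufficiency of \<open>TB i\<close> concerns prior means only, so \<xi> has
          to be integrated before factorizing. Fubini brings that integral inside the one over
          \<eta>, and the factorized prior turns it into a product of the means
          \<open>?mB i\<close>.\<close>
        then have mixB: "AE y in ?Y. ?p (\<theta>, y) = (\<integral>\<^sup>+ \<eta>. (\<Prod>i\<in>I. ?mB i (y i) \<eta>) \<partial>P)"
          using AE_space
        proof eventually_elim
          case (elim y)
          have yi: "y i \<in> space (MY i)" if "i \<in> I" for i using elim(2) that by (auto simp: space_PiM)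
          have "(\<lambda>z. ((fst z, y), snd z)) \<in> ?\<Pi> \<Otimes>\<^sub>M P \<rightarrow>\<^sub>M (?\<Pi> \<Otimes>\<^sub>M ?Y) \<Otimes>\<^sub>M P"
            using elim(2) by measurable
          from measurable_compose[OF this mr]
          have my: "(\<lambda>(\<xi>, \<eta>). \<Prod>i\<in>I. ?m i (y i) \<eta> (restrict \<xi> (C i))) \<in> borel_measurable (?\<Pi> \<Otimes>\<^sub>M P)"
            by (simp add: split_beta')
          have "?p (\<theta>, y) = (\<integral>\<^sup>+ \<xi>. (\<integral>\<^sup>+ \<eta>. (\<Prod>i\<in>I. ?m i (y i) \<eta> (restrict \<xi> (C i))) \<partial>P) \<partial>?\<Pi>)"
            using elim(1) by simp
          also have "\<dots> = (\<integral>\<^sup>+ \<eta>. (\<integral>\<^sup>+ \<xi>. (\<Prod>i\<in>I. ?m i (y i) \<eta> (restrict \<xi> (C i))) \<partial>?\<Pi>) \<partial>P)"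
            by (rule \<Pi>P.Fubini'[OF my, symmetric])
          also have "\<dots> = (\<integral>\<^sup>+ \<eta>. (\<Prod>i\<in>I. ?mB i (y i) \<eta>) \<partial>P)"
          proof (rule nn_integral_cong)
            fix \<eta> assume "\<eta> \<in> space P"
            then have \<eta>: "\<eta> \<in> space H" using sets_eq_imp_space_eq[OF sP] by simp
            show "(\<integral>\<^sup>+ \<xi>. (\<Prod>i\<in>I. ?m i (y i) \<eta> (restrict \<xi> (C i))) \<partial>?\<Pi>) = (\<Prod>i\<in>I. ?mB i (y i) \<eta>)"
            proof (rule nn_integral_factorized_prior[OF fin prior \<pi>i, where u = "\<lambda>i \<zeta>. ?m i (y i) \<eta> \<zeta>"])
              fix i assume i: "i \<in> I"
              show "(\<lambda>\<zeta>. ?m i (y i) \<eta> \<zeta>) \<in> borel_measurable (M\<xi>i i)"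
                using measurable_compose[OF measurable_Pair1'[of "(\<eta>, y i)" "H \<Otimes>\<^sub>M MY i"] mj[OF i]] \<eta> yi[OF i]
                by (simp add: space_pair_measure)
            qed
          qed
          finally show ?case .
        qed
        have mBprod: "(\<lambda>z. \<Prod>i\<in>I. ?mB i (snd z i) (fst z)) \<in> borel_measurable (P \<Otimes>\<^sub>M ?Y)"
        proof (rule borel_measurable_prod_ennreal)
          fix i assume i: "i \<in> I"
          have "(\<lambda>z. (fst z, snd z i)) \<in> P \<Otimes>\<^sub>M ?Y \<rightarrow>\<^sub>M H \<Otimes>\<^sub>M MY i" using i by measurable
          from measurable_compose[OF this mBm[OF i]]
          show "(\<lambda>z. ?mB i (snd z i) (fst z)) \<in> borel_measurable (P \<Otimes>\<^sub>M ?Y)" by simp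
        qed
        have facB: "factors_through ?Y (PiM I NB) (joint_statistic I TB) (\<lambda>y. \<Prod>i\<in>I. hB i (y i))
          (\<lambda>y. \<integral>\<^sup>+ \<eta>. (\<lambda>z. \<Prod>i\<in>I. ?mB i (snd z i) (fst z)) (\<eta>, y) \<partial>P)"
        proof (rule factors_through_nn_integral[OF P.sigma_finite_measure_axioms sfY TBm hBm mBprod])
          fix \<eta> assume "\<eta> \<in> space P"
          then have \<eta>: "\<eta> \<in> space H" using sets_eq_imp_space_eq[OF sP] by simp
          show "factors_through ?Y (PiM I NB) (joint_statistic I TB) (\<lambda>y. \<Prod>i\<in>I. hB i (y i))
            (\<lambda>y. (\<lambda>z. \<Prod>i\<in>I. ?mB i (snd z i) (fst z)) (\<eta>, y))"
            unfolding fst_conv snd_conv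
            by (rule factors_through_prod[OF fin base_Y kB[OF _ \<eta>] hB0])
        qed
        show "factors_through ?Y (PiM I NB) (joint_statistic I TB) (\<lambda>y. \<Prod>i\<in>I. hB i (y i)) (\<lambda>y. ?p (\<theta>, y))"
          by (rule factors_through_cong_AE[OF mixB facB[unfolded fst_conv snd_conv]])
      qed
    qed
    note posterior this
  }
  with likelihood show ?thesis by blast
qed

end
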